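(* Suppose that $\mathsf{E}\{\xi\}=0$ and $\mathsf{E}\{\xi^2\}=1$, and that for some $x_0>0$ $$F(x+\Delta)=p(x)e^{-R(x)},\qquad x\ge x_0,$$ where $p$ is long-tailed and intermediate regularly varying at infinity (hence $O$-regularly varying), and $R:[x_0,\infty)\to(0,\infty)$ is differentiable with $R'$ regularly varying at infinity with index $\beta-1$ for some $\beta\in(0,1)$. Then for any sequence $\{x_n\}$ in $[x_0,\infty)$ with $x_n/R(x_n)\gg\sqrt n$, we have $\mathsf{P}\{S_n\in x+\Delta\}\sim nF(x+\Delta)$ as $n\to\infty$ uniformly for $x\ge x_n$, that is, $$\lim_{n\to\infty}\ \sup_{x\ge x_n}\left|\frac{\mathsf{P}\{S_n\in x+\Delta\}}{nF(x+\Delta)}-1\right|=0 .$$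
   Context: Let $\xi,\xi_1,\xi_2,\dots$ be i.i.d. real random variables with distribution $F$, and $S_n=\xi_1+\cdots+\xi_n$. Fix $T\in(0,\infty]$; put $\Delta=(0,T]$ if $T<\infty$ and $\Delta=(0,\infty)$ if $T=\infty$, and $F(x+\Delta)=\mathsf{P}\{\xi\in x+\Delta\}$ (so $F(x+\Delta)=\mathsf{P}\{\xi>x\}$ when $T=\infty$). $f\gg g$ means $g/f\to0$. Let $p$ be a positive measurable function defined near infinity. It is long-tailed if $p(x+y)\sim p(x)$ as $x\to\infty$ for every $y\in\mathbb{R}$; $O$-regularly varying if $0<\liminf_{x\to\infty}p(xy)/p(x)\le\limsup_{x\to\infty}p(xy)/p(x)<\infty$ for every $y\ge1$; intermediate regularly varying if $\lim_{y\downarrow1}\liminf_{x\to\infty}p(xy)/p(x)=\lim_{y\downarrow1}\limsup_{x\to\infty}p(xy)/p(x)=1$ (this implies $O$-regular variation). *)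

theory Defs
  imports "HOL-Probability.Probability" "HOL-Library.Landau_Symbols"
begin

(* "Measurable" is read as Borel measurable. In HOL functions are total, so a function
   "defined near infinity" is one about whose values nothing is assumed below some a. *)
definition pos_measurable_near_infinity :: "(real \<Rightarrow> real) \<Rightarrow> bool" where
  "pos_measurable_near_infinity p \<longleftrightarrow>
     (\<exists>a. (\<forall>x\<ge>a. p x > 0) \<and> p \<in> borel_measurable (restrict_space borel {a..}))"

definition long_tailed :: "(real \<Rightarrow> real) \<Rightarrow> bool" where
  "long_tailed p \<longleftrightarrow>
     pos_measurable_near_infinity p \<and> (\<forall>y. (\<lambda>x. p (x + y)) \<sim>[at_top] p)"

(* The lower and upper limits are extended reals, since the quotients may be unbounded. *)
definition intermediate_regularly_varying :: "(real \<Rightarrow> real) \<Rightarrow> bool" where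
  "intermediate_regularly_varying p \<longleftrightarrow>
     pos_measurable_near_infinity p \<and>
     ((\<lambda>y. Liminf at_top (\<lambda>x. ereal (p (x * y) / p x))) \<longlongrightarrow> 1) (at_right 1) \<and>
     ((\<lambda>y. Limsup at_top (\<lambda>x. ereal (p (x * y) / p x))) \<longlongrightarrow> 1) (at_right 1)"

definition regularly_varying :: "real \<Rightarrow> (real \<Rightarrow> real) \<Rightarrow> bool" where
  "regularly_varying \<alpha> f \<longleftrightarrow>
     pos_measurable_near_infinity f \<and>
     (\<forall>y>0. ((\<lambda>x. f (x * y) / f x) \<longlongrightarrow> y powr \<alpha>) at_top)"

definition Delta :: "ereal \<Rightarrow> real set" where
  "Delta T = (if T = \<infinity> then {0<..} else {0<..real_of_ereal T})"

end

theory Submission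
  imports Defs "HOL-Real_Asymp.Real_Asymp"
begin

text \<open>A Steinhaus argument turns the pointwise hypotheses on \<open>R'\<close> and \<open>p\<close> into locally uniform ones.
  Consequently \<open>R x / x\<close> is eventually decreasing, \<open>R t / t \<ge> 2 powr (1 - \<gamma>) * (R x / x)\<close> for
  \<open>t \<le> x / 2\<close> with some \<open>\<gamma> < 1\<close>, and \<open>E exp ((1 - \<delta>) R(\<xi>))\<close> restricted to large \<open>\<xi>\<close> is finite.
  Hence for \<open>s = c R(x) / x\<close> with some \<open>c > 1\<close> the exponential moment of \<open>\<xi>\<close> truncated at
  \<open>x / 2\<close> is \<open>1 + O(s^2) + o(1 / n)\<close>, and \<open>n s^2\<close> tends to \<open>0\<close> for \<open>x \<ge> X n\<close>.
  By Chernoff's bound, the sum exceeds \<open>x\<close> while no summand exceeds \<open>x / 2\<close>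
  with probability of order \<open>exp (- c R x)\<close>, which is negligible, as is the event that two summands do.
  When only \<open>\<xi> i\<close> exceeds \<open>x / 2\<close>, condition on the sum \<open>W\<close> of the others: the local probability
  of \<open>\<xi> i\<close> at \<open>x - W\<close> is asymptotic to that at \<open>x\<close> if \<open>W\<close> is of order \<open>sqrt n\<close>, and at most
  \<open>C exp (s W)\<close> times it otherwise. The mean of \<open>exp (s W)\<close> tends to \<open>1\<close> and
  \<open>W\<close> of order \<open>sqrt n\<close> already accounts for nearly all of it.\<close>

section \<open>Regular variation\<close>

text \<open>The factor \<open>c > 1\<close> in the rate \<open>c * R x / x\<close> shapes the
  argument. With \<open>c = 1\<close> Chernoff's bound has order \<open>exp (- R x)\<close>, which
  need not be small against \<open>n * p x * exp (- R x)\<close>. Any \<open>c > 1\<close> leaves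
  \<open>exp (- (c - 1) * R x)\<close> to spare, and this beats both the polynomial lower bound on
  \<open>p\<close> and \<open>n\<close>, since eventually \<open>n \<le> x^2\<close>. Room for
  \<open>c\<close> comes from truncating at \<open>x / 2\<close> instead of \<open>x\<close>: there
  \<open>R t\<close> is at least \<open>2 powr (1 - \<gamma>)\<close> times the chord value
  \<open>(R x / x) * t\<close>. Two large summands fit the same budget, each costing
  \<open>exp (- c * R x / 2)\<close>. The delicate range is a sum \<open>W\<close> between order
  \<open>sqrt n\<close> and \<open>x / 2\<close>, where Chebyshev's inequality alone cannot
  compensate the factor \<open>exp (s W)\<close>. That range is never estimated directly: the mean
  of \<open>exp (s W)\<close> is at most about 1, typical \<open>W\<close> already contribute nearly
  1, and only the difference is left for the others. If typical means
  \<open>|W| \<le> K sqrt n\<close>, the loss has order \<open>1 / K^2\<close>, and \<open>K\<close>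
  is fixed by the tolerance before \<open>n\<close> grows.\<close>

lemma eventually_uniform_increments:
  fixes g :: "real \<Rightarrow> real"
  assumes meas: "g \<in> borel_measurable (restrict_space borel {a..})"
    and incr: "\<And>\<eta>. \<eta> > 0 \<Longrightarrow> \<exists>\<delta>>0. \<forall>u\<in>{0<..<\<delta>}. \<forall>\<^sub>F t in at_top. \<bar>g (t + u) - g t\<bar> < \<eta>"
    and "\<eta> > 0"
  shows "\<exists>\<delta>>0. \<exists>t1. \<forall>t\<ge>t1. \<forall>u\<in>{0..\<delta>}. \<bar>g (t + u) - g t\<bar> < \<eta>"
proof (rule ccontr)
  assume neg: "\<not> ?thesis"
  have "\<exists>t u. t \<ge> real n + \<bar>a\<bar> \<and> u \<in> {0..1 / (real n + 1)} \<and> \<bar>g (t + u) - g t\<bar> \<ge> \<eta>" for n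
  proof -
    have "1 / (real n + 1) > 0" by simp
    with neg have "\<not> (\<forall>t\<ge>real n + \<bar>a\<bar>. \<forall>u\<in>{0..1 / (real n + 1)}. \<bar>g (t + u) - g t\<bar> < \<eta>)"
      by blast
    then show ?thesis by (meson linorder_not_less)
  qed
  then obtain t u where t: "\<And>n. t n \<ge> real n + \<bar>a\<bar>"
    and u: "\<And>n. u n \<in> {0..1 / (real n + 1)}"
    and big: "\<And>n. \<bar>g (t n + u n) - g (t n)\<bar> \<ge> \<eta>" by metis
  have t_top: "filterlim t at_top sequentially"
  proof (rule filterlim_at_top_mono[OF filterlim_real_sequentially])
    show "\<forall>\<^sub>F n in sequentially. real n \<le> t n"
      using t by (auto intro!: always_eventually) (smt (verit) t)
  qed
  have u0: "u \<longlonglongrightarrow> 0"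
  proof (rule tendsto_sandwich[of "\<lambda>_. 0"])
    show "(\<lambda>n. 1 / (real n + 1)) \<longlonglongrightarrow> 0" using LIMSEQ_inverse_real_of_nat
      by (simp add: inverse_eq_divide add.commute)
  qed (use u in \<open>auto intro!: always_eventually\<close>)
  have tu_top: "filterlim (\<lambda>n. t n + u n) at_top sequentially"
    by (rule filterlim_at_top_mono[OF t_top]) (use u in auto)
  obtain \<delta> where \<delta>: "\<delta> > 0"
    and ev: "\<And>v. v \<in> {0<..<\<delta>} \<Longrightarrow> \<forall>\<^sub>F t in at_top. \<bar>g (t + v) - g t\<bar> < \<eta> / 2"
    using incr[of "\<eta>/2"] \<open>\<eta> > 0\<close> by auto
  \<comment> \<open>\<open>g\<close> is Borel only on \<open>{a..}\<close>; its extension by zero is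
    Borel everywhere, so the sets of good shifts below are measurable. Both sequences of base points
    stay above \<open>a\<close>, where \<open>h\<close> and \<open>g\<close> agree.\<close>
  define h where "h = (\<lambda>x. indicator {a..} x * g x)"
  have h_meas [measurable]: "h \<in> borel_measurable borel"
    using borel_measurable_restrict_space_iff[of "{a..}" borel g] meas
    by (simp add: h_def)
  have h_eq: "h x = g x" if "x \<ge> a" for x using that by (simp add: h_def)
  \<comment> \<open>Along a sequence tending to infinity, the shifts that are good from index
    \<open>k\<close> on increase with \<open>k\<close> to the whole interval, so some
    \<open>k\<close> leaves out less than a quarter of it. This is applied both to
    \<open>t n\<close> and to \<open>t n + u n\<close>.\<close>
  have good: "\<exists>k. measure lebesgue {v \<in> {0<..<\<delta>}. \<forall>n\<ge>k. \<bar>h (r n + v) - h (r n)\<bar> < \<eta>/2} > 3 * \<delta> / 4"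
    if r: "filterlim r at_top sequentially" and ra: "\<And>n. r n \<ge> a" for r :: "nat \<Rightarrow> real"
  proof -
    define A where "A = (\<lambda>k. {v \<in> {0<..<\<delta>}. \<forall>n\<ge>k. \<bar>h (r n + v) - h (r n)\<bar> < \<eta>/2})"
    have A_sets: "A k \<in> sets borel" for k
      unfolding A_def by measurable
    have inc: "incseq A" unfolding incseq_def A_def by auto
    have un: "(\<Union>k. A k) = {0<..<\<delta>}"
    proof
      show "{0<..<\<delta>} \<subseteq> (\<Union>k. A k)"
      proof
        fix v assume v: "v \<in> {0<..<\<delta>}"
        from filterlim_compose[OF _ r] ev[OF v]
        have "\<forall>\<^sub>F n in sequentially. \<bar>g (r n + v) - g (r n)\<bar> < \<eta>/2"
          using eventually_compose_filterlim r by blast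
        then obtain k where "\<And>n. n \<ge> k \<Longrightarrow> \<bar>g (r n + v) - g (r n)\<bar> < \<eta>/2"
          by (auto simp: eventually_sequentially)
        moreover have "r n + v \<ge> a" for n using ra[of n] v by auto
        ultimately have "v \<in> A k" using v ra by (auto simp: A_def h_eq)
        then show "v \<in> (\<Union>k. A k)" by blast
      qed
    qed (auto simp: A_def)
    have "(\<lambda>k. measure lebesgue (A k)) \<longlonglongrightarrow> measure lebesgue (\<Union>k. A k)"
      by (rule Lim_measure_incseq[OF _ inc])
        (use A_sets un \<delta> in auto)
    then have "(\<lambda>k. measure lebesgue (A k)) \<longlonglongrightarrow> \<delta>" using un \<delta> by simp
    then have "\<forall>\<^sub>F k in sequentially. measure lebesgue (A k) > 3 * \<delta> / 4"
      using \<delta> by (intro order_tendstoD) auto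
    then show ?thesis unfolding A_def by (auto simp: eventually_sequentially)
  qed
  have ta: "t n \<ge> a" for n using t[of n] by simp
  have tua: "t n + u n \<ge> a" for n using ta[of n] u[of n] by auto
  obtain k1 where k1: "measure lebesgue {v \<in> {0<..<\<delta>}. \<forall>n\<ge>k1. \<bar>h (t n + v) - h (t n)\<bar> < \<eta>/2} > 3 * \<delta> / 4"
    using good[OF t_top ta] by blast
  obtain k2 where k2: "measure lebesgue {v \<in> {0<..<\<delta>}. \<forall>n\<ge>k2. \<bar>h (t n + u n + v) - h (t n + u n)\<bar> < \<eta>/2} > 3 * \<delta> / 4"
    using good[OF tu_top tua] by blast
  have "\<forall>\<^sub>F n in sequentially. u n < \<delta> / 4" using u0 \<delta> by (intro order_tendstoD) auto
  then obtain n where n: "n \<ge> k1" "n \<ge> k2" "u n < \<delta> / 4"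
    by (metis (no_types, lifting) eventually_sequentially linorder_le_cases order_trans)
  define A where "A = {v \<in> {0<..<\<delta>}. \<forall>n\<ge>k1. \<bar>h (t n + v) - h (t n)\<bar> < \<eta>/2}"
  define B where "B = {v \<in> {0<..<\<delta>}. \<forall>n\<ge>k2. \<bar>h (t n + u n + v) - h (t n + u n)\<bar> < \<eta>/2}"
  define B' where "B' = (\<lambda>x. u n + x) ` B"
  have Ab: "A \<in> sets borel" unfolding A_def by measurable
  have Bb: "B \<in> sets borel" unfolding B_def by measurable
  have sub: "A \<subseteq> {0..5 * \<delta> / 4}" "B \<subseteq> {0..5 * \<delta> / 4}" "B' \<subseteq> {0..5 * \<delta> / 4}"
    using n u[of n] \<delta> by (auto simp: A_def B_def B'_def)
  have lmA: "A \<in> lmeasurable" and lmB: "B \<in> lmeasurable"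
    using Ab Bb sub bounded_subset[OF bounded_closed_interval]
    by (auto intro!: bounded_set_imp_lmeasurable)
  have lmB': "B' \<in> lmeasurable"
    unfolding B'_def using lmB by (rule measurable_translation)
  \<comment> \<open>Both sets lie in an interval of length \<open>5 * \<delta> / 4\<close>, because
    \<open>u n < \<delta> / 4\<close>, while their measures add up to more than
    \<open>3 * \<delta> / 2\<close>. A common point yields one endpoint \<open>t n + u n + v\<close>
    at which \<open>h\<close> differs by less than \<open>\<eta> / 2\<close> from its values at
    \<open>t n\<close> and at \<open>t n + u n\<close>.\<close>
  have "A \<inter> B' \<noteq> {}"
  proof
    assume disj: "A \<inter> B' = {}"
    have "measure lebesgue (A \<union> B') = measure lebesgue A + measure lebesgue B'"
      using lmA lmB' disj by (intro measure_Union) (auto simp: fmeasurable_def)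
    moreover have "measure lebesgue (A \<union> B') \<le> measure lebesgue {0..5 * \<delta> / 4}"
      using sub lmA lmB' by (intro measure_mono_fmeasurable) auto
    moreover have "measure lebesgue B' = measure lebesgue B"
      unfolding B'_def by (rule measure_translation)
    ultimately show False using k1 k2 \<delta> unfolding A_def[symmetric] B_def[symmetric] by simp
  qed
  then obtain v where "u n + v \<in> A" "v \<in> B" unfolding B'_def by auto
  then have "\<bar>h (t n + (u n + v)) - h (t n)\<bar> < \<eta>/2" "\<bar>h (t n + u n + v) - h (t n + u n)\<bar> < \<eta>/2"
    using n by (auto simp: A_def B_def)
  then have "\<bar>h (t n + u n) - h (t n)\<bar> < \<eta>"
    unfolding add.assoc by linarith
  with big[of n] show False using h_eq[OF ta] h_eq[OF tua] by simp
qed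

text \<open>The increment splits into whole steps of length \<open>\<delta>\<close>, which
  accumulate the slope \<open>\<rho>\<close>, and one remainder, which costs \<open>\<eta>\<close>.
  Keeping the two apart allows a small slope for regularly varying functions and the crude slope
  \<open>1 / \<delta>\<close> where increments are merely bounded.\<close>

lemma increments_chain:
  fixes g :: "real \<Rightarrow> real"
  assumes "\<delta> > 0" "t \<ge> t1" "u \<ge> 0"
    and small: "\<And>t u. t \<ge> t1 \<Longrightarrow> 0 \<le> u \<Longrightarrow> u \<le> \<delta> \<Longrightarrow> \<bar>g (t + u) - g t\<bar> \<le> \<eta>"
    and step: "\<And>t. t \<ge> t1 \<Longrightarrow> \<bar>g (t + \<delta>) - g t\<bar> \<le> \<rho> * \<delta>"
    and "\<rho> \<ge> 0"
  shows "\<bar>g (t + u) - g t\<bar> \<le> \<eta> + \<rho> * u"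
proof -
  have k_steps: "\<bar>g (t + real k * \<delta>) - g t\<bar> \<le> \<rho> * (real k * \<delta>)" for k
  proof (induction k)
    case (Suc k)
    have "t + real k * \<delta> \<ge> t1" using assms by (simp add: add_increasing2)
    from step[OF this] Suc show ?case by (simp add: algebra_simps)
  qed simp
  define k where "k = nat \<lfloor>u / \<delta>\<rfloor>"
  have "real k = of_int \<lfloor>u / \<delta>\<rfloor>" using assms by (simp add: k_def)
  then have "real k \<le> u / \<delta>" "u / \<delta> < real k + 1" by linarith+
  then have k: "real k * \<delta> \<le> u" "u \<le> real k * \<delta> + \<delta>"
    using \<open>\<delta> > 0\<close> by (auto simp: field_simps)
  have "t + real k * \<delta> \<ge> t1" using assms by (simp add: add_increasing2)
  from small[OF this, of "u - real k * \<delta>"] k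
  have "\<bar>g (t + u) - g (t + real k * \<delta>)\<bar> \<le> \<eta>" by (simp add: algebra_simps)
  moreover have "\<rho> * (real k * \<delta>) \<le> \<rho> * u" using k \<open>\<rho> \<ge> 0\<close> by (intro mult_left_mono)
  ultimately show ?thesis using k_steps[of k] by linarith
qed

section \<open>Power bounds obtained in logarithmic scale\<close>

lemma pos_measurable_near_infinity_ln_exp:
  assumes "pos_measurable_near_infinity f"
  obtains b where "\<And>t. t \<ge> b \<Longrightarrow> f (exp t) > 0"
    and "(\<lambda>t. ln (f (exp t)) - c * t) \<in> borel_measurable (restrict_space borel {b..})"
proof -
  obtain a where a: "\<And>x. x \<ge> a \<Longrightarrow> f x > 0" "f \<in> borel_measurable (restrict_space borel {a..})"
    using assms unfolding pos_measurable_near_infinity_def by blast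
  define b where "b = ln (max a 1)"
  have exp_ge: "exp t \<ge> a" if "t \<ge> b" for t
  proof -
    have "exp t \<ge> exp b" using that by simp
    then show ?thesis unfolding b_def by simp
  qed
  have "exp \<in> measurable (restrict_space borel {b..}) (restrict_space borel {a..})"
    by (rule measurable_restrict_space3) (use exp_ge in auto)
  from measurable_compose[OF this a(2)]
  have [measurable]: "(\<lambda>t. f (exp t)) \<in> borel_measurable (restrict_space borel {b..})" .
  have [measurable]: "(\<lambda>t::real. t) \<in> borel_measurable (restrict_space borel {b..})"
    by (rule measurable_restrict_space1) simp
  show ?thesis
    by (rule that[of b]) (use a exp_ge in \<open>auto\<close>)
qed

lemma ln_ratio_bounds:
  fixes f :: "real \<Rightarrow> real"
  assumes "0 < f x" "0 < f y" "0 < x" "x \<le> y"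
    and "\<bar>(ln (f y) - \<rho> * ln y) - (ln (f x) - \<rho> * ln x)\<bar> \<le> \<eta> + \<sigma> * (ln y - ln x)"
  shows "exp (-\<eta>) * (y / x) powr (\<rho> - \<sigma>) \<le> f y / f x"
    and "f y / f x \<le> exp \<eta> * (y / x) powr (\<rho> + \<sigma>)"
proof -
  have yx: "y / x > 0" using assms by simp
  have ln_yx: "ln (y / x) = ln y - ln x" using assms by (intro ln_divide_pos) auto
  have eq: "f y / f x = exp (ln (f y) - ln (f x))"
    using assms by (simp add: exp_diff)
  have "exp (-\<eta>) * (y / x) powr (\<rho> - \<sigma>) = exp (-\<eta> + (\<rho> - \<sigma>) * (ln y - ln x))"
    using yx assms by (simp add: powr_def ln_yx flip: exp_add)
  also have "\<dots> \<le> exp (ln (f y) - ln (f x))"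
    using assms(5) by (simp add: algebra_simps abs_le_iff)
  finally show "exp (-\<eta>) * (y / x) powr (\<rho> - \<sigma>) \<le> f y / f x" unfolding eq .
  have "exp (ln (f y) - ln (f x)) \<le> exp (\<eta> + (\<rho> + \<sigma>) * (ln y - ln x))"
    using assms(5) by (simp add: algebra_simps abs_le_iff)
  also have "\<dots> = exp \<eta> * (y / x) powr (\<rho> + \<sigma>)"
    using yx assms by (simp add: powr_def ln_yx flip: exp_add)
  finally show "f y / f x \<le> exp \<eta> * (y / x) powr (\<rho> + \<sigma>)" unfolding eq .
qed

text \<open>These are Potter's bounds. In the variable \<open>t = ln x\<close>, with the power of
  exponent \<open>\<rho>\<close> divided out, regular variation says that increments tend to zero;
  they are then uniformly small over short steps, and chaining such steps bounds long increments
  linearly.\<close>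

lemma regularly_varying_potter:
  assumes rv: "regularly_varying \<rho> f" and "\<epsilon> > 0"
  obtains a where "a > 0" "\<And>x. x \<ge> a \<Longrightarrow> f x > 0"
    and "\<And>x y. a \<le> x \<Longrightarrow> x \<le> y \<Longrightarrow> exp (-\<epsilon>) * (y / x) powr (\<rho> - \<epsilon>) \<le> f y / f x"
    and "\<And>x y. a \<le> x \<Longrightarrow> x \<le> y \<Longrightarrow> f y / f x \<le> exp \<epsilon> * (y / x) powr (\<rho> + \<epsilon>)"
proof -
  obtain b where pos: "\<And>t. t \<ge> b \<Longrightarrow> f (exp t) > 0"
    and meas: "(\<lambda>t. ln (f (exp t)) - \<rho> * t) \<in> borel_measurable (restrict_space borel {b..})"
    using pos_measurable_near_infinity_ln_exp[of f \<rho>] rv by (auto simp: regularly_varying_def)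
  define g where "g = (\<lambda>t. ln (f (exp t)) - \<rho> * t)"
  have lim: "((\<lambda>t. g (t + u) - g t) \<longlongrightarrow> 0) at_top" for u
  proof -
    have "((\<lambda>x. f (x * exp u) / f x) \<longlongrightarrow> exp u powr \<rho>) at_top"
      using rv by (simp add: regularly_varying_def)
    then have "((\<lambda>t. f (exp t * exp u) / f (exp t)) \<longlongrightarrow> exp u powr \<rho>) at_top"
      by (rule filterlim_compose) (rule exp_at_top)
    then have "((\<lambda>t. ln (f (exp t * exp u) / f (exp t)) - \<rho> * u) \<longlongrightarrow> ln (exp u powr \<rho>) - \<rho> * u) at_top"
      by (intro tendsto_intros) auto
    then have "((\<lambda>t. ln (f (exp t * exp u) / f (exp t)) - \<rho> * u) \<longlongrightarrow> 0) at_top"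
      by (simp add: ln_powr)
    then show ?thesis
    proof (rule Lim_transform_eventually)
      show "\<forall>\<^sub>F t in at_top. ln (f (exp t * exp u) / f (exp t)) - \<rho> * u = g (t + u) - g t"
        using eventually_ge_at_top[of "b + \<bar>u\<bar>"]
      proof eventually_elim
        case (elim t)
        then have "f (exp t) > 0" "f (exp (t + u)) > 0" by (auto intro!: pos)
        then show ?case
          by (simp add: g_def exp_add ln_div algebra_simps)
      qed
    qed
  qed
  obtain \<delta> t1 where \<delta>: "\<delta> > 0"
    and t1: "\<And>t u. t \<ge> t1 \<Longrightarrow> u \<in> {0..\<delta>} \<Longrightarrow> \<bar>g (t + u) - g t\<bar> < \<epsilon>"
  proof -
    have "\<exists>\<delta>>0. \<exists>t1. \<forall>t\<ge>t1. \<forall>u\<in>{0..\<delta>}. \<bar>g (t + u) - g t\<bar> < \<epsilon>"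
    proof (rule eventually_uniform_increments)
      fix \<eta> :: real assume "\<eta> > 0"
      then have "\<forall>\<^sub>F t in at_top. \<bar>g (t + u) - g t\<bar> < \<eta>" for u
        using tendstoD[OF lim[of u]] by (simp add: dist_real_def)
      then show "\<exists>\<delta>>0. \<forall>u\<in>{0<..<\<delta>}. \<forall>\<^sub>F t in at_top. \<bar>g (t + u) - g t\<bar> < \<eta>"
        by (intro exI[of _ 1]) auto
    qed (use meas \<open>\<epsilon> > 0\<close> in \<open>auto simp: g_def\<close>)
    then show ?thesis using that by blast
  qed
  \<comment> \<open>The increment over the fixed length \<open>\<delta>\<close> tends to zero, so it
    eventually falls below \<open>\<epsilon> * \<delta>\<close>, however small
    \<open>\<delta>\<close> came out. This makes the slope, and thus the error in the exponent,
    equal to \<open>\<epsilon>\<close>.\<close>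
  have "\<forall>\<^sub>F t in at_top. \<bar>g (t + \<delta>) - g t\<bar> < \<epsilon> * \<delta>"
    using tendstoD[OF lim[of \<delta>], of "\<epsilon> * \<delta>"] \<delta> \<open>\<epsilon> > 0\<close> by (simp add: dist_real_def)
  then obtain t2 where t2: "\<And>t. t \<ge> t2 \<Longrightarrow> \<bar>g (t + \<delta>) - g t\<bar> < \<epsilon> * \<delta>"
    by (auto simp: eventually_at_top_linorder)
  define t3 where "t3 = max b (max t1 t2)"
  have key: "\<bar>g (t + u) - g t\<bar> \<le> \<epsilon> + \<epsilon> * u" if "t \<ge> t3" "u \<ge> 0" for t u
  proof (rule increments_chain[OF \<delta> that])
    show "\<bar>g (t + u) - g t\<bar> \<le> \<epsilon>" if "t3 \<le> t" "0 \<le> u" "u \<le> \<delta>" for t u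
      using t1[of t u] that by (auto simp: t3_def)
    show "\<bar>g (t + \<delta>) - g t\<bar> \<le> \<epsilon> * \<delta>" if "t3 \<le> t" for t
      using t2[of t] that by (auto simp: t3_def)
  qed (use \<open>\<epsilon> > 0\<close> in auto)
  have fpos: "f x > 0" if "x \<ge> exp t3" for x
  proof -
    have x: "x > 0" using that exp_gt_zero[of t3] by linarith
    then have "ln x \<ge> t3" using that by (simp add: ln_ge_iff)
    then show ?thesis using pos[of "ln x"] x by (simp add: t3_def)
  qed
  have bd: "\<bar>(ln (f y) - \<rho> * ln y) - (ln (f x) - \<rho> * ln x)\<bar> \<le> \<epsilon> + \<epsilon> * (ln y - ln x)"
    and xpos: "0 < x" if "exp t3 \<le> x" "x \<le> y" for x y
  proof -
    show x: "x > 0" using that exp_gt_zero[of t3] by linarith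
    then have "ln x \<ge> t3" "ln y - ln x \<ge> 0" using that by (simp_all add: ln_ge_iff)
    from key[OF this] show "\<bar>(ln (f y) - \<rho> * ln y) - (ln (f x) - \<rho> * ln x)\<bar> \<le> \<epsilon> + \<epsilon> * (ln y - ln x)"
      using x that by (simp add: g_def)
  qed
  show ?thesis
  proof (rule that[of "exp t3"])
    fix x y assume xy: "exp t3 \<le> x" "x \<le> y"
    then have "f x > 0" "f y > 0" by (auto intro!: fpos)
    from ln_ratio_bounds[OF this xpos[OF xy] xy(2) bd[OF xy]]
    show "exp (-\<epsilon>) * (y / x) powr (\<rho> - \<epsilon>) \<le> f y / f x" "f y / f x \<le> exp \<epsilon> * (y / x) powr (\<rho> + \<epsilon>)"
      by auto
  qed (use fpos in auto)
qed

text \<open>Letting \<open>y\<close> decrease to 1 controls only the factors in some interval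
  \<open>(1, c)\<close> with \<open>c\<close> depending on \<open>\<eta>\<close>. For this reason
  the uniformity argument asks for good increments only on an interval whose length may depend on
  the tolerance.\<close>

lemma intermediate_regularly_varying_increments:
  assumes irv: "intermediate_regularly_varying p" and "\<eta> > 0"
  obtains \<delta> t1 where "\<delta> > 0" "\<And>t. t \<ge> t1 \<Longrightarrow> p (exp t) > 0"
    "\<And>t u. t \<ge> t1 \<Longrightarrow> 0 \<le> u \<Longrightarrow> u \<le> \<delta> \<Longrightarrow> \<bar>ln (p (exp (t + u))) - ln (p (exp t))\<bar> < \<eta>"
proof -
  obtain b where pos: "\<And>t. t \<ge> b \<Longrightarrow> p (exp t) > 0"
    and meas: "(\<lambda>t. ln (p (exp t)) - 0 * t) \<in> borel_measurable (restrict_space borel {b..})"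
    using pos_measurable_near_infinity_ln_exp[of p 0] irv
    by (auto simp: intermediate_regularly_varying_def)
  define g where "g = (\<lambda>t. ln (p (exp t)))"
  have "\<exists>\<delta>>0. \<exists>t1. \<forall>t\<ge>t1. \<forall>u\<in>{0..\<delta>}. \<bar>g (t + u) - g t\<bar> < \<eta>"
  proof (rule eventually_uniform_increments)
    fix \<eta> :: real assume \<eta>: "\<eta> > 0"
    have "\<forall>\<^sub>F y in at_right 1. ereal (exp (-\<eta>)) < Liminf at_top (\<lambda>x. ereal (p (x * y) / p x))"
      using irv \<eta> unfolding intermediate_regularly_varying_def
      by (intro order_tendstoD) (auto simp: one_ereal_def)
    moreover have "\<forall>\<^sub>F y in at_right 1. Limsup at_top (\<lambda>x. ereal (p (x * y) / p x)) < ereal (exp \<eta>)"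
      using irv \<eta> unfolding intermediate_regularly_varying_def
      by (intro order_tendstoD) (auto simp: one_ereal_def)
    ultimately have "\<forall>\<^sub>F y in at_right 1. \<forall>\<^sub>F x in at_top. exp (-\<eta>) < p (x * y) / p x \<and> p (x * y) / p x < exp \<eta>"
    proof eventually_elim
      case (elim y)
      from less_LiminfD[OF elim(1)] Limsup_lessD[OF elim(2)]
      show ?case by eventually_elim auto
    qed
    then obtain c where c: "c > 1"
      and ev: "\<And>y. 1 < y \<Longrightarrow> y < c \<Longrightarrow> \<forall>\<^sub>F x in at_top. exp (-\<eta>) < p (x * y) / p x \<and> p (x * y) / p x < exp \<eta>"
      unfolding eventually_at_right_field by auto
    have "\<forall>\<^sub>F t in at_top. \<bar>g (t + u) - g t\<bar> < \<eta>" if u: "u \<in> {0<..<ln c}" for u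
    proof -
      have "1 < exp u" "exp u < c" using u c by auto (metis exp_less_mono exp_ln less_trans zero_less_one)
      from eventually_compose_filterlim[OF ev[OF this] exp_at_top] eventually_ge_at_top[of "b"]
      show ?thesis
      proof eventually_elim
        case (elim t)
        then have P: "p (exp t) > 0" "p (exp (t + u)) > 0" using u by (auto intro!: pos)
        then have "p (exp t * exp u) / p (exp t) = exp (g (t + u) - g t)"
          by (simp add: g_def exp_diff exp_add)
        with elim show ?case by auto
      qed
    qed
    then show "\<exists>\<delta>>0. \<forall>u\<in>{0<..<\<delta>}. \<forall>\<^sub>F t in at_top. \<bar>g (t + u) - g t\<bar> < \<eta>"
      using c by (intro exI[of _ "ln c"]) auto
  qed (use meas \<open>\<eta> > 0\<close> in \<open>auto simp: g_def\<close>)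
  then obtain \<delta> t1 where "\<delta> > 0" "\<And>t u. t \<ge> t1 \<Longrightarrow> u \<in> {0..\<delta>} \<Longrightarrow> \<bar>g (t + u) - g t\<bar> < \<eta>"
    by blast
  then show ?thesis using pos by (intro that[of \<delta> "max t1 b"]) (auto simp: g_def)
qed

lemma intermediate_regularly_varying_near:
  assumes irv: "intermediate_regularly_varying p" and "\<eta> > 0"
  obtains \<delta> a where "\<delta> > 0" "a > 0" "\<And>x. x \<ge> a \<Longrightarrow> p x > 0"
    "\<And>x y. a \<le> x \<Longrightarrow> x \<le> y \<Longrightarrow> y \<le> (1 + \<delta>) * x \<Longrightarrow> exp (-\<eta>) \<le> p y / p x \<and> p y / p x \<le> exp \<eta>"
proof -
  obtain \<delta> t1 where \<delta>: "\<delta> > 0" and pos: "\<And>t. t \<ge> t1 \<Longrightarrow> p (exp t) > 0" and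
    incr: "\<And>t u. t \<ge> t1 \<Longrightarrow> 0 \<le> u \<Longrightarrow> u \<le> \<delta> \<Longrightarrow> \<bar>ln (p (exp (t + u))) - ln (p (exp t))\<bar> < \<eta>"
    using intermediate_regularly_varying_increments[OF assms] by metis
  have posx: "x > 0 \<and> ln x \<ge> t1 \<and> p x > 0" if "x \<ge> exp t1" for x
  proof -
    have x: "x > 0" using that exp_gt_zero[of t1] by linarith
    then have "ln x \<ge> t1" using that by (simp add: ln_ge_iff)
    then show ?thesis using pos[of "ln x"] x by simp
  qed
  show ?thesis
  proof (rule that[of \<delta> "exp t1"])
    fix x y assume xy: "exp t1 \<le> x" "x \<le> y" "y \<le> (1 + \<delta>) * x"
    have x: "x > 0" "ln x \<ge> t1" "p x > 0" "p y > 0" using posx xy by auto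
    have le: "ln y - ln x \<le> \<delta>"
    proof -
      have "ln y \<le> ln ((1 + \<delta>) * x)" using x xy by (intro ln_mono) auto
      also have "\<dots> = ln (1 + \<delta>) + ln x" using x \<delta> by (simp add: ln_mult_pos)
      also have "ln (1 + \<delta>) \<le> \<delta>" using \<delta> by (intro ln_add_one_self_le_self) auto
      finally show ?thesis by simp
    qed
    have "\<bar>ln (p (exp (ln x + (ln y - ln x)))) - ln (p (exp (ln x)))\<bar> < \<eta>"
      using x xy le by (intro incr) auto
    then have "\<bar>(ln (p y) - 0 * ln y) - (ln (p x) - 0 * ln x)\<bar> \<le> \<eta> + 0 * (ln y - ln x)"
      using x xy by simp
    from ln_ratio_bounds[OF x(3,4,1) xy(2) this]
    show "exp (-\<eta>) \<le> p y / p x \<and> p y / p x \<le> exp \<eta>" using x xy by simp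
  qed (use \<delta> posx in auto)
qed

text \<open>With tolerance 1, every logarithmic step of length \<open>\<delta>\<close> costs at most
  1, hence the exponent \<open>m = 1 / \<delta>\<close>. This quantifies the O-regular variation of
  \<open>p\<close>; \<open>m\<close> need not be small, as \<open>exp (- R x)\<close> will beat
  every power.\<close>

lemma intermediate_regularly_varying_polynomial:
  assumes irv: "intermediate_regularly_varying p"
  obtains m a where "m \<ge> 0" "a > 0" "\<And>x. x \<ge> a \<Longrightarrow> p x > 0"
    "\<And>x y. a \<le> x \<Longrightarrow> x \<le> y \<Longrightarrow> exp (-1) * (y / x) powr (-m) \<le> p y / p x"
    "\<And>x y. a \<le> x \<Longrightarrow> x \<le> y \<Longrightarrow> p y / p x \<le> exp 1 * (y / x) powr m"
proof -
  obtain \<delta> t1 where \<delta>: "\<delta> > 0" and pos: "\<And>t. t \<ge> t1 \<Longrightarrow> p (exp t) > 0" and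
    incr: "\<And>t u. t \<ge> t1 \<Longrightarrow> 0 \<le> u \<Longrightarrow> u \<le> \<delta> \<Longrightarrow> \<bar>ln (p (exp (t + u))) - ln (p (exp t))\<bar> < 1"
    using intermediate_regularly_varying_increments[OF assms, of 1] by (metis zero_less_one)
  define m where "m = 1 / \<delta>"
  have chain: "\<bar>ln (p (exp (t + u))) - ln (p (exp t))\<bar> \<le> 1 + m * u" if "t \<ge> t1" "u \<ge> 0" for t u
    by (rule increments_chain[OF \<delta> that, of "\<lambda>t. ln (p (exp t))"])
      (use incr \<delta> in \<open>auto simp: m_def less_imp_le\<close>)
  have posx: "x > 0 \<and> ln x \<ge> t1 \<and> p x > 0" if "x \<ge> exp t1" for x
  proof -
    have x: "x > 0" using that exp_gt_zero[of t1] by linarith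
    then have "ln x \<ge> t1" using that by (simp add: ln_ge_iff)
    then show ?thesis using pos[of "ln x"] x by simp
  qed
  have bd: "exp (-1) * (y / x) powr (-m) \<le> p y / p x \<and> p y / p x \<le> exp 1 * (y / x) powr m"
    if xy: "exp t1 \<le> x" "x \<le> y" for x y
  proof -
    have x: "x > 0" "ln x \<ge> t1" "p x > 0" "p y > 0" "ln y - ln x \<ge> 0" using posx xy by auto
    have "\<bar>ln (p y) - 0 * ln y - (ln (p x) - 0 * ln x)\<bar> \<le> 1 + m * (ln y - ln x)"
      using chain[OF x(2,5)] x xy by simp
    from ln_ratio_bounds[OF x(3,4,1) xy(2) this] show ?thesis by simp
  qed
  show ?thesis
    by (rule that[of m "exp t1"]) (use bd posx \<delta> in \<open>auto simp: m_def\<close>)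
qed

section \<open>Power growth of \<open>R\<close> from its derivative\<close>

lemma powr_comparison_of_log_derivative:
  fixes R R' :: "real \<Rightarrow> real"
  assumes x: "0 < x" "x \<le> y"
    and d: "\<And>t. x \<le> t \<Longrightarrow> t \<le> y \<Longrightarrow> (R has_real_derivative R' t) (at t)"
  shows "(\<And>t. x \<le> t \<Longrightarrow> t \<le> y \<Longrightarrow> \<alpha> * R t \<le> t * R' t) \<Longrightarrow> R x * (y / x) powr \<alpha> \<le> R y"
    and "(\<And>t. x \<le> t \<Longrightarrow> t \<le> y \<Longrightarrow> t * R' t \<le> \<alpha> * R t) \<Longrightarrow> R y \<le> R x * (y / x) powr \<alpha>"
proof -
  \<comment> \<open>Comparing \<open>t * R' t\<close> with \<open>\<alpha> * R t\<close> is the same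
    as fixing the sign of the derivative of this quotient.\<close>
  define h where "h = (\<lambda>t. R t * t powr (-\<alpha>))"
  have dh: "(h has_real_derivative (t * R' t - \<alpha> * R t) * t powr (-\<alpha> - 1)) (at t)"
    if "x \<le> t" "t \<le> y" for t
  proof -
    have "t > 0" using that x by simp
    then show ?thesis unfolding h_def
      by (auto intro!: derivative_eq_intros d[OF that] simp: algebra_simps powr_diff)
  qed
  have conv: "R y = h y * y powr \<alpha>" "R x * (y / x) powr \<alpha> = h x * y powr \<alpha>"
    using x by (simp_all add: h_def powr_minus powr_divide field_simps)
  show "R x * (y / x) powr \<alpha> \<le> R y" if "\<And>t. x \<le> t \<Longrightarrow> t \<le> y \<Longrightarrow> \<alpha> * R t \<le> t * R' t"
  proof -
    have "h x \<le> h y"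
      by (rule DERIV_nonneg_imp_nondecreasing[OF x(2)]) (use dh that in fastforce)
    then show ?thesis unfolding conv by (intro mult_right_mono) auto
  qed
  show "R y \<le> R x * (y / x) powr \<alpha>" if "\<And>t. x \<le> t \<Longrightarrow> t \<le> y \<Longrightarrow> t * R' t \<le> \<alpha> * R t"
  proof -
    have "h y \<le> h x"
    proof (rule DERIV_nonpos_imp_nonincreasing[OF x(2)])
      fix t assume t: "x \<le> t" "t \<le> y"
      have "(t * R' t - \<alpha> * R t) * t powr (-\<alpha> - 1) \<le> 0"
        using that[OF t] by (intro mult_nonpos_nonneg) auto
      with dh[OF t] show "\<exists>z. DERIV h t :> z \<and> z \<le> 0" by blast
    qed
    then show ?thesis unfolding conv by (intro mult_right_mono) auto
  qed
qed

text \<open>One half of Karamata's theorem: Potter's bounds for \<open>R'\<close> confine \<open>x R' x / R x\<close>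
  to a compact subset of \<open>(0, 1)\<close>.\<close>

lemma integrated_regular_variation:
  fixes R R' :: "real \<Rightarrow> real"
  assumes d0: "\<And>x. x \<ge> x0 \<Longrightarrow> (R has_real_derivative R' x) (at x within {x0..})"
    and Rpos: "\<And>x. x \<ge> x0 \<Longrightarrow> R x > 0"
    and rv: "regularly_varying (\<beta> - 1) R'" and \<beta>: "0 < \<beta>" "\<beta> < 1"
  obtains \<alpha> \<gamma> x1 where "0 < \<alpha>" "0 < \<gamma>" "\<gamma> < 1" "x1 > 0" "x1 \<ge> x0"
    "\<And>x y. x1 \<le> x \<Longrightarrow> x \<le> y \<Longrightarrow> R x * (y / x) powr \<alpha> \<le> R y"
    "\<And>x y. x1 \<le> x \<Longrightarrow> x \<le> y \<Longrightarrow> R y \<le> R x * (y / x) powr \<gamma>"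
proof -
  \<comment> \<open>The upper exponent will be
    \<open>\<gamma> = (\<beta> + \<epsilon>) * exp (2 * \<epsilon>)\<close>. One factor
    \<open>exp \<epsilon>\<close> is the constant in Potter's bound, the other absorbs the
    contribution of the lower endpoint \<open>c\<close>; \<open>\<epsilon>\<close> is chosen so that
    the product stays below 1.\<close>
  have "((\<lambda>e. (\<beta> + e) * exp (2 * e)) \<longlongrightarrow> (\<beta> + 0) * exp (2 * 0)) (at_right (0::real))"
    by (intro tendsto_intros)
  then have "\<forall>\<^sub>F e in at_right 0. (\<beta> + e) * exp (2 * e) < 1" using \<beta> by (intro order_tendstoD) auto
  moreover have "\<forall>\<^sub>F e in at_right 0. e \<in> {0<..<\<beta>}"
    using \<beta> by (intro eventually_at_right_real)
  ultimately have "\<forall>\<^sub>F e in at_right 0. (\<beta> + e) * exp (2 * e) < 1 \<and> e < \<beta> \<and> 0 < e"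
    by eventually_elim auto
  from eventually_happens'[OF trivial_limit_at_right_real this]
  obtain \<epsilon> where \<epsilon>: "(\<beta> + \<epsilon>) * exp (2 * \<epsilon>) < 1" "\<epsilon> < \<beta>" "0 < \<epsilon>" by auto
  obtain a where a: "a > 0" "\<And>x. x \<ge> a \<Longrightarrow> R' x > 0"
    and lo: "\<And>x y. a \<le> x \<Longrightarrow> x \<le> y \<Longrightarrow> exp (-\<epsilon>) * (y / x) powr (\<beta> - 1 - \<epsilon>) \<le> R' y / R' x"
    and up: "\<And>x y. a \<le> x \<Longrightarrow> x \<le> y \<Longrightarrow> R' y / R' x \<le> exp \<epsilon> * (y / x) powr (\<beta> - 1 + \<epsilon>)"
    using regularly_varying_potter[OF rv \<epsilon>(3)] by metis
  \<comment> \<open>Staying strictly above \<open>x0\<close> turns the derivative within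
    \<open>{x0..}\<close> into a two-sided one.\<close>
  define c where "c = max a (\<bar>x0\<bar> + 1)"
  have c: "c > 0" "c \<ge> a" "c > x0" using a by (auto simp: c_def)
  have d: "(R has_real_derivative R' x) (at x)" if "x \<ge> c" for x
  proof -
    have "x \<in> interior {x0..}" using that c by simp
    then have "at x within {x0..} = at x" by (rule at_within_interior)
    then show ?thesis using d0[of x] that c by simp
  qed
  define b b' where "b = \<beta> + \<epsilon>" and "b' = \<beta> - \<epsilon>"
  have b: "b > 0" "b' > 0" using \<epsilon> \<beta> by (auto simp: b_def b'_def)
  \<comment> \<open>Potter's bound anchored at the right end \<open>x\<close> gives
    \<open>R' t \<ge> K * t powr (b - 1)\<close> on \<open>[c, x]\<close>. Monotonicity of the
    difference between \<open>R\<close> and the primitive of the right-hand side concludes, so no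
    integral of \<open>R'\<close> has to be formed.\<close>
  have R_lower: "R x - R c \<ge> exp (-\<epsilon>) * x * R' x * (1 - (c / x) powr b) / b" if x: "x \<ge> c" for x
  proof -
    define K where "K = exp (-\<epsilon>) * R' x * x powr (1 - b)"
    have "R c - K * c powr b / b \<le> R x - K * x powr b / b"
    proof (rule DERIV_nonneg_imp_nondecreasing[OF x])
      fix t assume t: "c \<le> t" "t \<le> x"
      have tpos: "t > 0" "R' t > 0" "x > 0" "R' x > 0" using t c a by auto
      have "R' x \<le> (exp \<epsilon> * (x / t) powr (b - 1)) * R' t"
        using up[of t x] t c tpos by (simp add: b_def field_simps)
      then have "R' x * (exp (-\<epsilon>) * (x / t) powr (1 - b)) \<le>
          (exp \<epsilon> * (x / t) powr (b - 1)) * R' t * (exp (-\<epsilon>) * (x / t) powr (1 - b))"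
        by (intro mult_right_mono) auto
      also have "\<dots> = R' t"
      proof -
        have "(x / t) powr (b - 1) * (x / t) powr (1 - b) = 1"
          using tpos by (simp flip: powr_add)
        moreover have "exp \<epsilon> * exp (-\<epsilon>) = 1" by (simp flip: exp_add)
        moreover have "(e * P) * r * (e' * Q) = (e * e') * (P * Q) * r" for e e' P Q r :: real by simp
        ultimately show ?thesis by (metis mult_1)
      qed
      also have "R' x * (exp (-\<epsilon>) * (x / t) powr (1 - b)) = K * t powr (b - 1)"
        using tpos by (simp add: K_def powr_divide powr_diff field_simps)
      finally have "0 \<le> R' t - K * t powr (b - 1)" by simp
      moreover have "((\<lambda>t. R t - K * t powr b / b) has_real_derivative (R' t - K * t powr (b - 1))) (at t)"
        using tpos b by (auto intro!: derivative_eq_intros d t)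
      ultimately show "\<exists>y. ((\<lambda>t. R t - K * t powr b / b) has_real_derivative y) (at t) \<and> 0 \<le> y" by blast
    qed
    then have "R x - R c \<ge> K * (x powr b - c powr b) / b"
      by (simp add: right_diff_distrib diff_divide_distrib)
    also have "K * (x powr b - c powr b) / b = exp (-\<epsilon>) * x * R' x * (1 - (c / x) powr b) / b"
      using x c by (simp add: K_def powr_divide powr_diff field_simps)
    finally show ?thesis .
  qed
  have R_upper: "R x - R c \<le> exp \<epsilon> * x * R' x / b'" if x: "x \<ge> c" for x
  proof -
    define K where "K = exp \<epsilon> * R' x * x powr (1 - b')"
    have Kpos: "K \<ge> 0" using a c x by (auto simp: K_def less_imp_le)
    have "R x - K * x powr b' / b' \<le> R c - K * c powr b' / b'"
    proof (rule DERIV_nonpos_imp_nonincreasing[OF x])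
      fix t assume t: "c \<le> t" "t \<le> x"
      have tpos: "t > 0" "R' t > 0" "x > 0" "R' x > 0" using t c a by auto
      have "(exp (-\<epsilon>) * (x / t) powr (b' - 1)) * R' t \<le> R' x"
        using lo[of t x] t c tpos by (simp add: b'_def field_simps)
      then have "(exp (-\<epsilon>) * (x / t) powr (b' - 1)) * R' t * (exp \<epsilon> * (x / t) powr (1 - b'))
          \<le> R' x * (exp \<epsilon> * (x / t) powr (1 - b'))"
        by (intro mult_right_mono) auto
      also have "R' x * (exp \<epsilon> * (x / t) powr (1 - b')) = K * t powr (b' - 1)"
        using tpos by (simp add: K_def powr_divide powr_diff field_simps)
      also have "(exp (-\<epsilon>) * (x / t) powr (b' - 1)) * R' t * (exp \<epsilon> * (x / t) powr (1 - b')) = R' t"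
      proof -
        have "(x / t) powr (b' - 1) * (x / t) powr (1 - b') = 1"
          using tpos by (simp flip: powr_add)
        moreover have "exp (-\<epsilon>) * exp \<epsilon> = 1" by (simp flip: exp_add)
        moreover have "(e * P) * r * (e' * Q) = (e * e') * (P * Q) * r" for e e' P Q r :: real by simp
        ultimately show ?thesis by (metis mult_1)
      qed
      finally have "R' t - K * t powr (b' - 1) \<le> 0" by simp
      moreover have "((\<lambda>t. R t - K * t powr b' / b') has_real_derivative (R' t - K * t powr (b' - 1))) (at t)"
        using tpos b by (auto intro!: derivative_eq_intros d t)
      ultimately show "\<exists>y. ((\<lambda>t. R t - K * t powr b' / b') has_real_derivative y) (at t) \<and> y \<le> 0" by blast
    qed
    then have "R x - R c \<le> K * x powr b' / b' - K * c powr b' / b'" by simp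
    also have "\<dots> \<le> K * x powr b' / b'" using Kpos b by simp
    also have "\<dots> = exp \<epsilon> * x * R' x / b'" using x c by (simp add: K_def powr_diff field_simps)
    finally show ?thesis .
  qed
  \<comment> \<open>Since \<open>x * R' x\<close> stays above \<open>c0\<close>, the additive
    constant \<open>R c\<close> in the upper estimate of \<open>R x\<close> is at most a fixed
    multiple of \<open>x * R' x\<close>. The second summand of \<open>A\<close> below absorbs
    it.\<close>
  define c0 where "c0 = c * R' c * exp (-\<epsilon>)"
  have Rc: "R' c > 0" using a c by auto
  have c0: "c0 > 0" using c Rc by (simp add: c0_def)
  have xR': "x * R' x \<ge> c0" if x: "x \<ge> c" for x
  proof -
    have "exp (-\<epsilon>) * (x / c) powr (b' - 1) * R' c \<le> R' x"
      using lo[of c x] x c Rc by (simp add: b'_def field_simps)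
    then have "x * (exp (-\<epsilon>) * (x / c) powr (b' - 1) * R' c) \<le> x * R' x"
      using x c by (intro mult_left_mono) auto
    also have "x * (exp (-\<epsilon>) * (x / c) powr (b' - 1) * R' c) = c0 * (x / c) powr b'"
      using x c by (simp add: c0_def powr_diff powr_divide field_simps)
    finally have "c0 * (x / c) powr b' \<le> x * R' x" .
    moreover have "(x / c) powr b' \<ge> 1" using x c b by (intro ge_one_powr_ge_zero) auto
    moreover from calculation(2) have "c0 * 1 \<le> c0 * (x / c) powr b'"
      using c0 by (intro mult_left_mono) auto
    ultimately show ?thesis by linarith
  qed
  define A where "A = exp \<epsilon> / b' + R c / c0"
  have Apos: "A > 0" using Rpos[of c] c c0 b by (auto simp: A_def intro!: add_pos_pos divide_pos_pos)
  have up1: "R x \<le> A * (x * R' x)" if x: "x \<ge> c" for x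
  proof -
    have "R c / c0 * c0 \<le> R c / c0 * (x * R' x)"
      using xR'[OF x] Rpos[of c] c c0 by (intro mult_left_mono) auto
    then have "R c \<le> R c / c0 * (x * R' x)" using c0 by simp
    then show ?thesis using R_upper[OF x] by (simp add: A_def algebra_simps)
  qed
  have "((\<lambda>x. (c / x) powr b) \<longlongrightarrow> 0) at_top"
  proof -
    have "((\<lambda>x. c powr b * x powr (-b)) \<longlongrightarrow> c powr b * 0) at_top"
      using b by (intro tendsto_intros tendsto_neg_powr filterlim_ident) auto
    moreover have "\<forall>\<^sub>F x in at_top. c powr b * x powr (-b) = (c / x) powr b"
      using eventually_gt_at_top[of 0]
      by eventually_elim (use c in \<open>simp add: powr_divide powr_minus field_simps\<close>)
    ultimately show ?thesis by (auto intro: Lim_transform_eventually)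
  qed
  then have "\<forall>\<^sub>F x in at_top. (c / x) powr b < 1 - exp (-\<epsilon>)"
    using \<epsilon> by (intro order_tendstoD) auto
  then obtain c1 where c1: "\<And>x. x \<ge> c1 \<Longrightarrow> (c / x) powr b < 1 - exp (-\<epsilon>)"
    by (auto simp: eventually_at_top_linorder)
  define x1 where "x1 = max c c1"
  define \<gamma> where "\<gamma> = b * exp (2 * \<epsilon>)"
  have x1: "x1 \<ge> c" "x1 \<ge> c1" by (auto simp: x1_def)
  have low1: "x * R' x \<le> \<gamma> * R x" if x: "x \<ge> x1" for x
  proof -
    have pos: "x * R' x > 0" using xR'[of x] c0 x x1 by auto
    have "exp (-\<epsilon>) \<le> 1 - (c / x) powr b" using c1[of x] x x1 by auto
    then have "exp (-\<epsilon>) * (x * R' x) * exp (-\<epsilon>) / b \<le> exp (-\<epsilon>) * (x * R' x) * (1 - (c / x) powr b) / b"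
      using pos b by (intro divide_right_mono mult_left_mono) auto
    also have "\<dots> \<le> R x" using R_lower[of x] x x1 Rpos[of c] c by (simp add: algebra_simps)
    finally have "exp (-\<epsilon>) * (x * R' x) * exp (-\<epsilon>) / b * (b * exp (2 * \<epsilon>)) \<le> R x * (b * exp (2 * \<epsilon>))"
      using b by (intro mult_right_mono) auto
    moreover have "exp (-\<epsilon>) * (x * R' x) * exp (-\<epsilon>) / b * (b * exp (2 * \<epsilon>)) = x * R' x * (exp (-\<epsilon>) * exp (-\<epsilon>) * exp (2 * \<epsilon>))"
      using b by simp
    moreover have "exp (-\<epsilon>) * exp (-\<epsilon>) * exp (2 * \<epsilon>) = 1" by (simp flip: exp_add)
    ultimately show ?thesis by (simp add: \<gamma>_def mult.commute)
  qed
  show ?thesis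
  proof (rule that[of "1 / A" \<gamma> x1])
    fix x y assume xy: "x1 \<le> x" "x \<le> y"
    have x: "0 < x" using xy x1 c by auto
    show "R x * (y / x) powr (1 / A) \<le> R y"
    proof (rule powr_comparison_of_log_derivative(1)[OF x xy(2)])
      fix t assume "x \<le> t" "t \<le> y"
      then show "1 / A * R t \<le> t * R' t" using up1[of t] xy x1 Apos by (simp add: field_simps)
    qed (use d xy x1 in auto)
    show "R y \<le> R x * (y / x) powr \<gamma>"
      by (rule powr_comparison_of_log_derivative(2)[OF x xy(2), where R' = R']) (use d low1 xy x1 in auto)
  qed (use Apos b \<epsilon> x1 c in \<open>auto simp: \<gamma>_def b_def\<close>)
qed

section \<open>Analysis of the tail function\<close>

text \<open>These are the quantitative facts kept from regular variation; \<open>R'\<close> and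
  \<open>\<beta>\<close> no longer appear. One threshold \<open>x1\<close> serves all bounds except
  \<open>p_near\<close>, whose threshold depends on the tolerance. The function \<open>q\<close>
  will be the probability of \<open>x + \<Delta>\<close>.\<close>

locale stretched_tail =
  fixes R p q :: "real \<Rightarrow> real" and \<alpha> \<gamma> m x1 :: real
  assumes params: "0 < \<alpha>" "0 < \<gamma>" "\<gamma> < 1" "0 \<le> m" "0 < x1"
    and R_pos: "\<And>x. x1 \<le> x \<Longrightarrow> 0 < R x"
    and R_lower: "\<And>x y. x1 \<le> x \<Longrightarrow> x \<le> y \<Longrightarrow> R x * (y / x) powr \<alpha> \<le> R y"
    and R_upper: "\<And>x y. x1 \<le> x \<Longrightarrow> x \<le> y \<Longrightarrow> R y \<le> R x * (y / x) powr \<gamma>"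
    and p_pos: "\<And>x. x1 \<le> x \<Longrightarrow> 0 < p x"
    and p_lower: "\<And>x y. x1 \<le> x \<Longrightarrow> x \<le> y \<Longrightarrow> exp (-1) * (y / x) powr (-m) \<le> p y / p x"
    and p_upper: "\<And>x y. x1 \<le> x \<Longrightarrow> x \<le> y \<Longrightarrow> p y / p x \<le> exp 1 * (y / x) powr m"
    and p_near: "\<And>\<eta>. 0 < \<eta> \<Longrightarrow> \<exists>\<delta>>0. \<exists>a. \<forall>x y. a \<le> x \<longrightarrow> x \<le> y \<longrightarrow> y \<le> (1 + \<delta>) * x \<longrightarrow>
        exp (-\<eta>) \<le> p y / p x \<and> p y / p x \<le> exp \<eta>"
    and q_eq: "\<And>x. x1 \<le> x \<Longrightarrow> q x = p x * exp (- R x)"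
begin

section \<open>Slopes and growth of \<open>R\<close>\<close>

lemma q_pos: "x1 \<le> x \<Longrightarrow> 0 < q x"
  by (simp add: q_eq p_pos)

lemma R_mono:
  assumes "x1 \<le> x" "x \<le> y"
  shows "R x \<le> R y"
proof -
  have "1 \<le> (y / x) powr \<alpha>" using assms params by (intro ge_one_powr_ge_zero) auto
  then have "R x * 1 \<le> R x * (y / x) powr \<alpha>" using R_pos[OF assms(1)] by (intro mult_left_mono) auto
  then show ?thesis using R_lower[OF assms] by simp
qed

lemma R_ge_power_fraction:
  assumes "x1 \<le> x" "x \<le> y"
  shows "(x / y) powr \<gamma> * R y \<le> R x"
proof -
  have "(x / y) powr \<gamma> * R y \<le> (x / y) powr \<gamma> * (R x * (y / x) powr \<gamma>)"
    using R_upper[OF assms] by (intro mult_left_mono) auto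
  also have "\<dots> = R x" using assms params by (simp add: powr_divide)
  finally show ?thesis .
qed

lemma R_ge_fraction:
  assumes "x1 \<le> x" "x \<le> y"
  shows "x / y * R y \<le> R x"
proof -
  have "(x / y) powr 1 \<le> (x / y) powr \<gamma>"
    using assms params by (intro powr_mono') auto
  then have "x / y * R y \<le> (x / y) powr \<gamma> * R y"
    using assms params R_pos[of y] by (intro mult_right_mono) auto
  then show ?thesis using R_ge_power_fraction[OF assms] by simp
qed

lemma R_over_antimono:
  assumes "x1 \<le> x" "x \<le> y"
  shows "R y / y \<le> R x / x"
  using R_ge_fraction[OF assms] assms params by (simp add: field_simps)

text \<open>On \<open>[x1, y]\<close> the graph of \<open>R\<close> lies above the chord from the
  origin to \<open>(y, R y)\<close>, so between \<open>x\<close> and \<open>y\<close> it climbs with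
  mean slope at most \<open>R y / y\<close>. This takes the place of concavity, which is not
  assumed.\<close>

lemma R_diff_le:
  assumes "x1 \<le> x" "x \<le> y"
  shows "R y - R x \<le> (y - x) * (R y / y)"
  using R_ge_fraction[OF assms] assms params by (simp add: field_simps)

text \<open>For \<open>t \<le> x / 2\<close> the factor \<open>(x / t) powr (1 - \<gamma>)\<close>
  is at least its value at ratio 2, which exceeds 1 because \<open>\<gamma> < 1\<close>. This strict
  gain permits exponential rates above \<open>R x / x\<close> after truncation at
  \<open>x / 2\<close>.\<close>

lemma R_halved_ge:
  assumes "x1 \<le> t" "t \<le> x / 2"
  shows "2 powr (1 - \<gamma>) * (R x / x) * t \<le> R t"
proof -
  have x: "0 < t" "t \<le> x" "0 < R x" using assms params R_pos[of x] by auto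
  have "2 powr (1 - \<gamma>) \<le> (x / t) powr (1 - \<gamma>)"
    using assms x params by (intro powr_mono2) (auto simp: field_simps)
  then have "2 powr (1 - \<gamma>) * (R x / x * t) \<le> (x / t) powr (1 - \<gamma>) * (R x / x * t)"
    using x by (intro mult_right_mono) auto
  also have "\<dots> = (t / x) powr \<gamma> * R x"
    using x by (simp add: powr_diff powr_divide field_simps)
  also have "\<dots> \<le> R t" using R_ge_power_fraction[of t x] assms x by simp
  finally show ?thesis by (simp add: mult.assoc)
qed

lemma R_at_top: "filterlim R at_top at_top"
proof (rule filterlim_at_top_mono)
  have "R x1 > 0" using R_pos[of x1] by simp
  then show "filterlim (\<lambda>x. R x1 * (x / x1) powr \<alpha>) at_top at_top"
    using params by real_asymp
  show "\<forall>\<^sub>F x in at_top. R x1 * (x / x1) powr \<alpha> \<le> R x"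
    using eventually_ge_at_top[of x1] by eventually_elim (use R_lower[of x1] in auto)
qed

lemma powr_times_exp_R_tendsto:
  assumes "\<epsilon> > 0"
  shows "((\<lambda>x. x powr k * exp (- \<epsilon> * R x)) \<longlongrightarrow> 0) at_top"
proof (rule tendsto_sandwich[of "\<lambda>_. 0"])
  have "R x1 > 0" using R_pos[of x1] by simp
  then show "((\<lambda>x. x powr k * exp (- \<epsilon> * (R x1 * (x / x1) powr \<alpha>))) \<longlongrightarrow> 0) at_top"
    using params assms by real_asymp
  show "\<forall>\<^sub>F x in at_top. x powr k * exp (- \<epsilon> * R x) \<le> x powr k * exp (- \<epsilon> * (R x1 * (x / x1) powr \<alpha>))"
    using eventually_ge_at_top[of x1]
    by eventually_elim (use R_lower[of x1] assms in \<open>auto intro!: mult_left_mono\<close>)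
qed auto

lemma p_polynomial_bounds:
  obtains c where "c > 0" "\<And>x. x1 \<le> x \<Longrightarrow> c * x powr (-m) \<le> p x" "\<And>x. x1 \<le> x \<Longrightarrow> p x \<le> x powr m / c"
proof -
  define c where "c = min (exp (-1) * p x1 * x1 powr m) (x1 powr m / (exp 1 * p x1))"
  have pp: "p x1 > 0" using p_pos[of x1] by simp
  have c: "c > 0" using pp params by (simp add: c_def)
  have "c * x powr (-m) \<le> p x" if "x1 \<le> x" for x
  proof -
    have "c * x powr (-m) \<le> exp (-1) * p x1 * x1 powr m * x powr (-m)"
      by (intro mult_right_mono) (auto simp: c_def)
    also have "\<dots> = exp (-1) * (x / x1) powr (-m) * p x1"
      using that params by (simp add: powr_divide powr_minus field_simps)
    also have "\<dots> \<le> p x" using p_lower[of x1 x] that pp by (simp add: pos_le_divide_eq)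
    finally show ?thesis .
  qed
  moreover have "p x \<le> x powr m / c" if "x1 \<le> x" for x
  proof -
    have "p x \<le> exp 1 * (x / x1) powr m * p x1"
      using p_upper[of x1 x] that pp by (simp add: pos_divide_le_eq)
    also have "\<dots> = x powr m / (x1 powr m / (exp 1 * p x1))"
      using that params pp by (simp add: powr_divide field_simps)
    also have "\<dots> \<le> x powr m / c"
      using c pp params by (intro divide_left_mono mult_pos_pos) (auto simp: c_def)
    finally show ?thesis .
  qed
  ultimately show ?thesis using that c by blast
qed

text \<open>For \<open>z \<ge> 0\<close> the argument at most halves, so \<open>p\<close> costs a
  constant factor and \<open>R\<close> drops by at most \<open>z * R x / x\<close>. For
  \<open>z < 0\<close> the argument moves right, where \<open>p\<close> may grow, but only
  polynomially, and the decay of \<open>exp (- R)\<close> compensates for it.\<close>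

lemma q_shift_le:
  obtains C x2 where "C \<ge> 1" "x2 \<ge> x1"
    "\<And>x z. x2 \<le> x \<Longrightarrow> z \<le> x / 2 \<Longrightarrow> q (x - z) \<le> C * q x * exp (R x / x * max z 0)"
proof -
  \<comment> \<open>To the right of \<open>x\<close>, \<open>R t\<close> exceeds \<open>R x\<close>
    by at least \<open>\<alpha> * R x * ln (t / x)\<close>; once
    \<open>R x \<ge> m / \<alpha>\<close> this covers the growth \<open>m * ln (t / x)\<close> of
    the logarithm of \<open>p\<close>.\<close>
  have "\<forall>\<^sub>F x in at_top. R x \<ge> m / \<alpha>"
    using R_at_top by (simp add: filterlim_at_top)
  then obtain x3 where x3: "\<And>x. x \<ge> x3 \<Longrightarrow> R x \<ge> m / \<alpha>" by (auto simp: eventually_at_top_linorder)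
  define C where "C = exp 1 * 2 powr m"
  have "exp 1 * 1 \<le> C" unfolding C_def using params by (intro mult_left_mono ge_one_powr_ge_zero) auto
  then have C: "C \<ge> exp 1" "C \<ge> 1" using one_le_exp_iff[of 1] by linarith+
  show ?thesis
  proof (rule that[of C "max x3 (2 * x1)"])
    fix x z assume x: "max x3 (2 * x1) \<le> x" and z: "z \<le> x / 2"
    define t where "t = x - z"
    have t: "x1 \<le> t" "x1 \<le> x" "x > 0" "t > 0" using x z params by (auto simp: t_def)
    note pp = p_pos[OF t(1)] p_pos[OF t(2)]
    show "q (x - z) \<le> C * q x * exp (R x / x * max z 0)"
    proof (cases "z \<ge> 0")
      case True
      then have tx: "t \<le> x" "x / t \<le> 2" using z t by (auto simp: t_def field_simps)
      have "p t * (exp (-1) * (x / t) powr (-m)) \<le> p x"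
        using p_lower[OF t(1) tx(1)] pp by (simp add: field_simps)
      then have "p t * (exp (-1) * (x / t) powr (-m)) * (exp 1 * (x / t) powr m) \<le> p x * (exp 1 * (x / t) powr m)"
        by (intro mult_right_mono) auto
      then have "p t \<le> p x * (exp 1 * (x / t) powr m)"
        using t by (simp add: exp_minus powr_minus field_simps)
      also have "\<dots> \<le> p x * C"
        unfolding C_def using pp tx t params by (intro mult_left_mono powr_mono2) auto
      finally have "p t * exp (- R t) \<le> p x * C * exp (- R t)" by (intro mult_right_mono) auto
      also have "\<dots> \<le> p x * C * (exp (- R x) * exp (R x / x * z))"
        using R_diff_le[OF t(1) tx(1)] pp C
        by (intro mult_left_mono) (auto simp: t_def mult.commute simp flip: exp_add)
      finally show ?thesis using True t by (simp add: q_eq t_def mult_ac)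
    next
      case False
      then have tx: "x \<le> t" "0 \<le> ln (t / x)" using t by (auto simp: t_def)
      have "R x * (1 + \<alpha> * ln (t / x)) \<le> R x * exp (\<alpha> * ln (t / x))"
        using R_pos[OF t(2)] exp_ge_add_one_self[of "\<alpha> * ln (t / x)"] by (intro mult_left_mono) auto
      also have "\<dots> \<le> R t" using R_lower[OF t(2) tx(1)] t by (simp add: powr_def)
      finally have Rt: "R x + R x * \<alpha> * ln (t / x) \<le> R t" by (simp add: algebra_simps)
      have "m * ln (t / x) \<le> R x * \<alpha> * ln (t / x)"
        using x3[of x] x tx params by (intro mult_right_mono) (auto simp: field_simps)
      with Rt have le: "m * ln (t / x) - R t \<le> - R x" by simp
      have "p t \<le> exp 1 * (t / x) powr m * p x"
        using p_upper[OF t(2) tx(1)] pp by (simp add: field_simps)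
      then have "p t * exp (- R t) \<le> exp 1 * (t / x) powr m * p x * exp (- R t)"
        by (intro mult_right_mono) auto
      also have "\<dots> = exp 1 * p x * exp (m * ln (t / x) - R t)"
        using t by (simp add: powr_def exp_diff exp_minus field_simps)
      also have "\<dots> \<le> C * p x * exp (- R x)"
        using le pp C by (intro mult_mono) auto
      finally show ?thesis using False t by (simp add: q_eq t_def mult_ac)
    qed
  qed (use C params in auto)
qed

lemma q_near:
  assumes "\<eta> > 0"
  obtains \<delta> x2 where "\<delta> > 0" "x2 \<ge> x1"
    "\<And>x z. x2 \<le> x \<Longrightarrow> \<bar>z\<bar> \<le> \<delta> * x \<Longrightarrow> \<bar>z\<bar> * (R x / x) \<le> \<delta> \<Longrightarrow>
       exp (-\<eta>) * q x \<le> q (x - z) \<and> q (x - z) \<le> exp \<eta> * q x"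
proof -
  obtain \<delta>0 a where \<delta>0: "\<delta>0 > 0" and near: "\<And>x y. a \<le> x \<Longrightarrow> x \<le> y \<Longrightarrow> y \<le> (1 + \<delta>0) * x \<Longrightarrow>
        exp (-(\<eta>/2)) \<le> p y / p x \<and> p y / p x \<le> exp (\<eta>/2)"
    using p_near[of "\<eta> / 2"] assms by auto
  \<comment> \<open>The entry \<open>\<eta> / 2\<close> bounds the change of \<open>R\<close>, the
    other half of \<open>\<eta>\<close> being left for \<open>p\<close>; \<open>1/2\<close> keeps
    \<open>x - z\<close> above \<open>x / 2\<close>; \<open>\<delta>0 / (1 + \<delta>0)\<close>
    ensures \<open>x \<le> (1 + \<delta>0) * (x - z)\<close>, as \<open>p\<close> is compared from
    the smaller point upwards.\<close>
  define \<delta> where "\<delta> = min (\<eta> / 2) (min (1/2) (\<delta>0 / (1 + \<delta>0)))"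
  have \<delta>: "\<delta> > 0" "\<delta> \<le> \<eta> / 2" "\<delta> \<le> 1/2" "\<delta> \<le> \<delta>0" "\<delta> * (1 + \<delta>0) \<le> \<delta>0"
  proof -
    have "\<delta>0 / (1 + \<delta>0) > 0" using \<delta>0 by simp
    then show "\<delta> > 0" "\<delta> \<le> \<eta> / 2" "\<delta> \<le> 1/2" using assms
      unfolding \<delta>_def by linarith+
    have "\<delta> \<le> \<delta>0 / (1 + \<delta>0)" by (simp add: \<delta>_def)
    then show le: "\<delta> * (1 + \<delta>0) \<le> \<delta>0" using \<delta>0 by (simp add: pos_le_divide_eq)
    have "\<delta> * 1 \<le> \<delta> * (1 + \<delta>0)" using \<delta>0 \<open>\<delta> > 0\<close> by (intro mult_left_mono) auto
    then show "\<delta> \<le> \<delta>0" using le by simp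
  qed
  have comb: "exp (-\<eta>) * (u * exp (-v)) \<le> u' * exp (-v') \<and> u' * exp (-v') \<le> exp \<eta> * (u * exp (-v))"
    if "u > 0" "u' > 0" "exp (-(\<eta>/2)) \<le> u' / u" "u' / u \<le> exp (\<eta>/2)" "\<bar>v' - v\<bar> \<le> \<eta> / 2" for u u' v v' :: real
  proof -
    have v: "-(\<eta>/2) - v \<le> - v'" "- v' \<le> \<eta>/2 - v" using that(5) by linarith+
    have "exp (-\<eta>) * (u * exp (-v)) = (exp (-(\<eta>/2)) * u) * exp (-(\<eta>/2) - v)"
      by (simp add: mult_ac flip: exp_add)
    also have "\<dots> \<le> u' * exp (-v')"
      using that v by (intro mult_mono) (auto simp: pos_le_divide_eq)
    finally have 1: "exp (-\<eta>) * (u * exp (-v)) \<le> u' * exp (-v')" .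
    have "u' * exp (-v') \<le> (exp (\<eta>/2) * u) * exp (\<eta>/2 - v)"
      using that v by (intro mult_mono) (auto simp: pos_divide_le_eq)
    also have "\<dots> = exp \<eta> * (u * exp (-v))" by (simp add: mult_ac flip: exp_add)
    finally show ?thesis using 1 by blast
  qed
  have swap: "exp (-(\<eta>/2)) \<le> u / u' \<and> u / u' \<le> exp (\<eta>/2)"
    if "u > 0" "u' > 0" "exp (-(\<eta>/2)) \<le> u' / u" "u' / u \<le> exp (\<eta>/2)" for u u' :: real
    using that by (auto simp: exp_minus field_simps)
  show ?thesis
  proof (rule that[of \<delta> "max (2 * \<bar>a\<bar>) (2 * x1)"])
    fix x z assume x: "max (2 * \<bar>a\<bar>) (2 * x1) \<le> x" and z: "\<bar>z\<bar> \<le> \<delta> * x" "\<bar>z\<bar> * (R x / x) \<le> \<delta>"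
    have x': "x \<ge> x1" "x > 0" using x params by auto
    have "\<delta> * x \<le> 1/2 * x" using \<delta> x' by (intro mult_right_mono) auto
    then have "\<bar>z\<bar> \<le> x / 2" using z by linarith
    then have t: "x - z \<ge> x1" "x - z \<ge> a" "x - z > 0" using x params by auto
    note pp = p_pos[OF t(1)] p_pos[OF x'(1)]
    have R: "\<bar>R (x - z) - R x\<bar> \<le> \<eta> / 2"
    proof (cases "z \<ge> 0")
      case True
      then show ?thesis using R_diff_le[OF t(1), of x] R_mono[OF t(1), of x] z \<delta> by auto
    next
      case False
      then have "R (x - z) - R x \<le> (- z) * (R (x - z) / (x - z))"
        using R_diff_le[OF x'(1), of "x - z"] by simp
      also have "\<dots> \<le> (- z) * (R x / x)"
        using False R_over_antimono[OF x'(1), of "x - z"] by (intro mult_left_mono) auto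
      finally show ?thesis using R_mono[OF x'(1), of "x - z"] z \<delta> False by auto
    qed
    have "exp (-(\<eta>/2)) \<le> p (x - z) / p x \<and> p (x - z) / p x \<le> exp (\<eta>/2)"
    proof (cases "z \<ge> 0")
      case True
      have "(1 + \<delta>0) * z \<le> (1 + \<delta>0) * (\<delta> * x)" using z True \<delta>0 by (intro mult_left_mono) auto
      also have "\<dots> = (\<delta> * (1 + \<delta>0)) * x" by simp
      also have "\<dots> \<le> \<delta>0 * x" using \<delta>(5) x' by (intro mult_right_mono) auto
      finally have "x \<le> (1 + \<delta>0) * (x - z)" by (simp add: algebra_simps)
      then have "exp (-(\<eta>/2)) \<le> p x / p (x - z) \<and> p x / p (x - z) \<le> exp (\<eta>/2)"
        using near[OF t(2), of x] True by simp
      then show ?thesis using swap[OF pp] by blast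
    next
      case False
      have "\<delta> * x \<le> \<delta>0 * x" using \<delta> x' by (intro mult_right_mono) auto
      then have "x - z \<le> (1 + \<delta>0) * x" using z False by (simp add: algebra_simps)
      then show ?thesis using near[of x "x - z"] False x by auto
    qed
    then show "exp (-\<eta>) * q x \<le> q (x - z) \<and> q (x - z) \<le> exp \<eta> * q x"
      using comb pp R by (simp add: q_eq t x')
  qed (use \<delta> params in auto)
qed

text \<open>Mass is controlled only on blocks \<open>{y<..y + \<tau>}\<close>, so the half-line is
  cut into such blocks. Over one block \<open>R\<close> grows by a bounded amount, so up to a
  constant the exponential may be taken at the left end, where
  \<open>q y * exp ((1 - \<delta>) * R y) \<le> 1 / y^2\<close> makes the series converge.\<close>

lemma exponential_moment:
  assumes F: "finite_measure F" "sets F = sets borel"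
    and \<tau>: "\<tau> > 0" "\<And>y. x1 \<le> y \<Longrightarrow> measure F {y<..y + \<tau>} \<le> q y"
    and \<delta>: "0 < \<delta>" "\<delta> < 1"
  obtains x2 where "x2 \<ge> x1" "integrable F (\<lambda>x. indicator {x2<..} x * exp ((1 - \<delta>) * R x))"
proof -
  interpret F: finite_measure F by fact
  obtain c where c: "c > 0" "\<And>x. x1 \<le> x \<Longrightarrow> p x \<le> x powr m / c" using p_polynomial_bounds by metis
  have "\<forall>\<^sub>F x in at_top. x powr (m + 2) * exp (- \<delta> * R x) < c"
    using powr_times_exp_R_tendsto[OF \<delta>(1)] c by (intro order_tendstoD) auto
  then obtain a where a: "\<And>x. x \<ge> a \<Longrightarrow> x powr (m + 2) * exp (- \<delta> * R x) < c"
    by (auto simp: eventually_at_top_linorder)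
  define x2 where "x2 = max a x1"
  have x2: "x2 \<ge> x1" "x2 > 0" using params by (auto simp: x2_def)
  have q_bound: "q x * exp ((1 - \<delta>) * R x) \<le> 1 / x\<^sup>2" if "x \<ge> x2" for x
  proof -
    have x: "x \<ge> x1" "x \<ge> a" "x > 0" using that x2 by (auto simp: x2_def)
    have "q x * exp ((1 - \<delta>) * R x) = p x * exp (- \<delta> * R x)"
      by (simp add: q_eq x mult.assoc algebra_simps flip: exp_add)
    also have "\<dots> \<le> x powr m / c * exp (- \<delta> * R x)" using c x by (intro mult_right_mono) auto
    also have "\<dots> = (x powr (m + 2) * exp (- \<delta> * R x)) / c / x\<^sup>2"
      using x by (simp add: powr_add field_simps power2_eq_square)
    also have "\<dots> \<le> 1 / x\<^sup>2" using a[of x] x c by (intro divide_right_mono) (auto simp: field_simps)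
    finally show ?thesis .
  qed
  define y where "y = (\<lambda>k. x2 + real k * \<tau>)"
  define c1 where "c1 = \<tau> * (R x1 / x1)"
  have y_ge: "y k \<ge> x2" for k using \<tau> by (simp add: y_def)
  have y_Suc: "y (Suc k) = y k + \<tau>" for k by (simp add: y_def algebra_simps)
  have R_step: "R (y (Suc k)) \<le> R (y k) + c1" for k
  proof -
    have yk: "x1 \<le> y k" using y_ge[of k] x2 by simp
    have "R (y (Suc k)) - R (y k) \<le> \<tau> * (R (y (Suc k)) / y (Suc k))"
      using R_diff_le[OF yk, of "y (Suc k)"] \<tau> y_Suc by simp
    also have "\<dots> \<le> c1" unfolding c1_def
      using R_over_antimono[of x1 "y (Suc k)"] yk \<tau> y_Suc by (intro mult_left_mono) auto
    finally show ?thesis by simp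
  qed
  \<comment> \<open>This makes \<open>y k \<ge> \<sigma> * (k + 1)\<close>, including
    \<open>k = 0\<close> where \<open>y 0 = x2\<close>, so the inverse squares dominate the
    series.\<close>
  define \<sigma> where "\<sigma> = min x2 \<tau>"
  have \<sigma>: "\<sigma> > 0" using x2 \<tau> by (simp add: \<sigma>_def)
  define b where "b = (\<lambda>k. exp c1 / \<sigma>\<^sup>2 * (1 / (real (Suc k))\<^sup>2))"
  have term_le: "measure F {y k<..y (Suc k)} * exp ((1 - \<delta>) * R (y (Suc k))) \<le> b k" for k
  proof -
    have yk: "x1 \<le> y k" using y_ge[of k] x2 by simp
    have "R x1 > 0" using R_pos[of x1] by simp
    then have "c1 \<ge> 0" using params \<tau> by (simp add: c1_def)
    have "\<sigma> * real (Suc k) \<le> y k"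
    proof -
      have "\<sigma> * real k \<le> \<tau> * real k" by (intro mult_right_mono) (auto simp: \<sigma>_def)
      then show ?thesis by (simp add: y_def algebra_simps) (simp add: \<sigma>_def)
    qed
    then have sq: "(\<sigma> * real (Suc k))\<^sup>2 \<le> (y k)\<^sup>2" using \<sigma> by (intro power_mono) auto
    have "(1 - \<delta>) * R (y (Suc k)) \<le> (1 - \<delta>) * R (y k) + c1"
    proof -
      have "(1 - \<delta>) * R (y (Suc k)) \<le> (1 - \<delta>) * (R (y k) + c1)"
        using R_step \<delta> by (intro mult_left_mono) auto
      moreover have "(1 - \<delta>) * c1 \<le> 1 * c1" using \<delta> \<open>c1 \<ge> 0\<close> by (intro mult_right_mono) auto
      ultimately show ?thesis by (simp add: algebra_simps)
    qed
    then have "measure F {y k<..y (Suc k)} * exp ((1 - \<delta>) * R (y (Suc k)))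
        \<le> q (y k) * (exp ((1 - \<delta>) * R (y k)) * exp c1)"
      using \<tau>(2)[OF yk] q_pos[OF yk] by (intro mult_mono) (auto simp: y_Suc simp flip: exp_add)
    also have "\<dots> \<le> 1 / (y k)\<^sup>2 * exp c1"
      using mult_right_mono[OF q_bound[OF y_ge[of k]], of "exp c1"] by (simp add: mult.assoc)
    also have "\<dots> \<le> 1 / (\<sigma> * real (Suc k))\<^sup>2 * exp c1"
      using sq \<sigma> by (intro mult_right_mono divide_left_mono mult_pos_pos) (auto intro!: zero_less_power simp del: of_nat_Suc)
    also have "\<dots> = b k"
      unfolding b_def power_mult_distrib by simp
    finally show ?thesis .
  qed
  have summ: "summable b" unfolding b_def
    using inverse_squares_sums
    by (intro summable_mult) (auto simp: sums_iff add.commute)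
  define f where "f = (\<lambda>x. indicator {x2<..} x * exp ((1 - \<delta>) * R x))"
  \<comment> \<open>Monotonicity supplies the measurability of \<open>R\<close> on
    \<open>{x1..}\<close>; the indicator extends it to the whole line.\<close>
  have "mono_on {x1..} R" by (auto intro!: mono_onI R_mono)
  then have "R \<in> borel_measurable (restrict_space borel {x1..})" by (rule borel_measurable_mono_on_fnc)
  then have [measurable]: "(\<lambda>x. indicator {x1..} x * R x) \<in> borel_measurable borel"
    by (subst (asm) borel_measurable_restrict_space_iff) auto
  have "f = (\<lambda>x. indicator {x2<..} x * exp ((1 - \<delta>) * (indicator {x1..} x * R x)))"
    using x2 by (auto simp: f_def indicator_def fun_eq_iff)
  then have "f \<in> borel_measurable borel" by simp
  then have f_meas: "f \<in> borel_measurable F" using measurable_cong_sets[OF F(2) refl] by blast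
  have bound: "ennreal (f x) \<le> (\<Sum>k. ennreal (exp ((1 - \<delta>) * R (y (Suc k)))) * indicator {y k<..y (Suc k)} x)" for x
  proof (cases "x > x2")
    case True
    \<comment> \<open>Blocks are open on the left, so a point equal to \<open>y (Suc k)\<close>
      belongs to block \<open>k\<close>: hence the ceiling minus one.\<close>
    define k where "k = nat (\<lceil>(x - x2) / \<tau>\<rceil> - 1)"
    have "(x - x2) / \<tau> > 0" using True \<tau> by simp
    then have "real k = of_int \<lceil>(x - x2) / \<tau>\<rceil> - 1" by (simp add: k_def)
    then have "real k < (x - x2) / \<tau>" "(x - x2) / \<tau> \<le> real k + 1" by linarith+
    then have k: "y k < x" "x \<le> y (Suc k)" using \<tau> by (auto simp: y_def field_simps)
    have "f x \<le> exp ((1 - \<delta>) * R (y (Suc k)))"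
      using True x2 k \<delta> R_mono[of x "y (Suc k)"] by (auto simp: f_def)
    then have "ennreal (f x) \<le> ennreal (exp ((1 - \<delta>) * R (y (Suc k)))) * indicator {y k<..y (Suc k)} x"
      using k by (simp add: ennreal_leI)
    also have "\<dots> = (\<Sum>i\<in>{k}. ennreal (exp ((1 - \<delta>) * R (y (Suc i)))) * indicator {y i<..y (Suc i)} x)"
      by (subst sum.insert) auto
    also have "\<dots> \<le> (\<Sum>k. ennreal (exp ((1 - \<delta>) * R (y (Suc k)))) * indicator {y k<..y (Suc k)} x)"
      by (intro sum_le_suminf) auto
    finally show ?thesis .
  qed (simp add: f_def)
  have "(\<integral>\<^sup>+x. ennreal (f x) \<partial>F) \<le>
      (\<integral>\<^sup>+x. (\<Sum>k. ennreal (exp ((1 - \<delta>) * R (y (Suc k)))) * indicator {y k<..y (Suc k)} x) \<partial>F)"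
    by (intro nn_integral_mono bound)
  also have "\<dots> = (\<Sum>k. \<integral>\<^sup>+x. ennreal (exp ((1 - \<delta>) * R (y (Suc k)))) * indicator {y k<..y (Suc k)} x \<partial>F)"
    using F by (intro nn_integral_suminf) auto
  also have "\<dots> = (\<Sum>k. ennreal (exp ((1 - \<delta>) * R (y (Suc k)))) * emeasure F {y k<..y (Suc k)})"
    using F by (simp add: nn_integral_cmult_indicator)
  also have "\<dots> \<le> (\<Sum>k. ennreal (b k))"
  proof (intro suminf_le)
    fix k
    show "ennreal (exp ((1 - \<delta>) * R (y (Suc k)))) * emeasure F {y k<..y (Suc k)} \<le> ennreal (b k)"
      unfolding F.emeasure_eq_measure using term_le[of k]
      by (simp add: ennreal_mult'[symmetric] ennreal_leI mult.commute)
  qed auto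
  also have "\<dots> < \<infinity>" using summ by (subst suminf_ennreal2) (auto simp: b_def)
  finally have "integrable F f"
    using f_meas by (intro integrableI_nonneg) (auto simp: f_def)
  then show ?thesis using that x2 unfolding f_def by blast
qed

end

section \<open>Sums of independent variables and a single big jump\<close>

text \<open>Independence makes the joint law a product, and Fubini's theorem integrates over its
  sections. The target spaces are arbitrary because \<open>Y\<close> will be the vector of all
  remaining summands.\<close>

lemma (in prob_space) indep_var_section:
  assumes ind: "indep_var N X L Y"
    and P: "Measurable.pred (N \<Otimes>\<^sub>M L) (\<lambda>w. P (fst w) (snd w))"
  shows "integrable M (\<lambda>\<omega>. measure (distr M N X) {a \<in> space N. P a (Y \<omega>)})"
    and "prob {\<omega> \<in> space M. P (X \<omega>) (Y \<omega>)} =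
      (\<integral>\<omega>. measure (distr M N X) {a \<in> space N. P a (Y \<omega>)} \<partial>M)"
proof -
  have X: "X \<in> measurable M N" and Y: "Y \<in> measurable M L"
    and eq: "distr M N X \<Otimes>\<^sub>M distr M L Y = distr M (N \<Otimes>\<^sub>M L) (\<lambda>\<omega>. (X \<omega>, Y \<omega>))"
    using ind unfolding indep_var_distribution_eq by auto
  interpret X: prob_space "distr M N X" using X by (rule prob_space_distr)
  interpret Y: prob_space "distr M L Y" using Y by (rule prob_space_distr)
  interpret P: pair_sigma_finite "distr M N X" "distr M L Y" ..
  define A where "A = {w \<in> space (N \<Otimes>\<^sub>M L). P (fst w) (snd w)}"
  have A: "A \<in> sets (N \<Otimes>\<^sub>M L)" unfolding A_def using P by (simp add: pred_def)
  have A': "A \<in> sets (distr M N X \<Otimes>\<^sub>M distr M L Y)" using A by (simp add: eq)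
  have slice: "(\<lambda>a. (a, y)) -` A = {a \<in> space N. P a y}" if "y \<in> space L" for y
    using that by (auto simp: A_def space_pair_measure)
  have [measurable]: "(\<lambda>y. emeasure (distr M N X) ((\<lambda>a. (a, y)) -` A)) \<in> borel_measurable L"
    using P.measurable_emeasure_Pair2[OF A'] by simp
  have emX: "emeasure (distr M N X) S = ennreal (measure (distr M N X) S)" for S
    by (rule X.emeasure_eq_measure)
  have "(\<lambda>\<omega>. measure (distr M N X) ((\<lambda>a. (a, Y \<omega>)) -` A)) \<in> borel_measurable M"
    unfolding measure_def using Y by measurable
  also have "?this \<longleftrightarrow> (\<lambda>\<omega>. measure (distr M N X) {a \<in> space N. P a (Y \<omega>)}) \<in> borel_measurable M"
    by (intro measurable_cong) (use slice measurable_space[OF Y] in auto)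
  finally have meas: "(\<lambda>\<omega>. measure (distr M N X) {a \<in> space N. P a (Y \<omega>)}) \<in> borel_measurable M" .
  show int: "integrable M (\<lambda>\<omega>. measure (distr M N X) {a \<in> space N. P a (Y \<omega>)})"
    by (rule integrable_const_bound[of _ 1]) (use meas in \<open>auto intro: X.prob_le_1\<close>)
  have "emeasure M {\<omega> \<in> space M. P (X \<omega>) (Y \<omega>)} = emeasure (distr M (N \<Otimes>\<^sub>M L) (\<lambda>\<omega>. (X \<omega>, Y \<omega>))) A"
    using A X Y
    by (subst emeasure_distr)
      (auto intro!: arg_cong2[of _ _ _ _ emeasure] simp: A_def space_pair_measure dest: measurable_space)
  also have "\<dots> = (\<integral>\<^sup>+y. emeasure (distr M N X) ((\<lambda>a. (a, y)) -` A) \<partial>distr M L Y)"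
    unfolding eq[symmetric] by (rule P.emeasure_pair_measure_alt2[OF A'])
  also have "\<dots> = (\<integral>\<^sup>+\<omega>. emeasure (distr M N X) ((\<lambda>a. (a, Y \<omega>)) -` A) \<partial>M)"
    using Y by (subst nn_integral_distr) auto
  also have "\<dots> = (\<integral>\<^sup>+\<omega>. ennreal (measure (distr M N X) {a \<in> space N. P a (Y \<omega>)}) \<partial>M)"
    by (intro nn_integral_cong) (use slice measurable_space[OF Y] emX in auto)
  also have "\<dots> = ennreal (\<integral>\<omega>. measure (distr M N X) {a \<in> space N. P a (Y \<omega>)} \<partial>M)"
    using int by (intro nn_integral_eq_integral) auto
  finally show "prob {\<omega> \<in> space M. P (X \<omega>) (Y \<omega>)} =
      (\<integral>\<omega>. measure (distr M N X) {a \<in> space N. P a (Y \<omega>)} \<partial>M)"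
    by (simp add: emeasure_eq_measure integral_nonneg_AE)
qed

locale standardized_iid = prob_space M for M :: "'a measure" +
  fixes \<xi> :: "nat \<Rightarrow> 'a \<Rightarrow> real" and F :: "real measure"
  assumes indep: "indep_vars (\<lambda>_. borel) \<xi> UNIV"
    and distr_eq: "\<And>i. distr M borel (\<xi> i) = F"
    and integrable_0: "integrable M (\<xi> 0)" and mean_0: "expectation (\<xi> 0) = 0"
    and square_integrable_0: "integrable M (\<lambda>\<omega>. (\<xi> 0 \<omega>)\<^sup>2)"
    and variance_0: "expectation (\<lambda>\<omega>. (\<xi> 0 \<omega>)\<^sup>2) = 1"
begin

lemma rv [measurable]: "random_variable borel (\<xi> i)"
  using indep by (simp add: indep_vars_def)

lemma sets_F [measurable_cong, simp]: "sets F = sets borel"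
  using distr_eq[of 0] by (metis sets_distr)

lemma space_F [simp]: "space F = UNIV"
  using sets_eq_imp_space_eq[OF sets_F] by simp

sublocale F: prob_space F
  using prob_space_distr[OF rv[of 0]] by (simp add: distr_eq)

lemma integral_F:
  assumes "f \<in> borel_measurable borel"
  shows "(\<integral>t. f t \<partial>F) = expectation (\<lambda>\<omega>. f (\<xi> i \<omega>) :: real)"
    and "integrable F f \<longleftrightarrow> integrable M (\<lambda>\<omega>. f (\<xi> i \<omega>))"
  using assms by (simp_all add: distr_eq[of i, symmetric] integral_distr integrable_distr_eq)

lemma prob_F:
  assumes "A \<in> sets borel"
  shows "prob {\<omega> \<in> space M. \<xi> i \<omega> \<in> A} = measure F A"
  using assms by (simp add: distr_eq[of i, symmetric] measure_distr vimage_def Int_def conj_commute)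

lemma moments_F: "integrable F (\<lambda>t. t)" "(\<integral>t. t \<partial>F) = 0" "integrable F (\<lambda>t. t\<^sup>2)" "(\<integral>t. t\<^sup>2 \<partial>F) = 1"
  using integrable_0 mean_0 square_integrable_0 variance_0
  by (simp_all add: integral_F[where i = 0])

lemma moments: "integrable M (\<xi> i)" "expectation (\<xi> i) = 0"
   "integrable M (\<lambda>\<omega>. (\<xi> i \<omega>)\<^sup>2)" "expectation (\<lambda>\<omega>. (\<xi> i \<omega>)\<^sup>2) = 1"
  using moments_F by (simp_all add: integral_F[where i = i])

section \<open>Second moments and union bounds\<close>

lemma sum_second_moment:
  assumes "finite J"
  shows "integrable M (\<lambda>\<omega>. (\<Sum>j\<in>J. \<xi> j \<omega>)\<^sup>2) \<and> expectation (\<lambda>\<omega>. (\<Sum>j\<in>J. \<xi> j \<omega>)\<^sup>2) = card J"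
  using assms
proof induction
  case (insert i J)
  have "indep_var borel (\<xi> i) borel (\<lambda>\<omega>. \<Sum>j\<in>J. \<xi> j \<omega>)"
    using insert by (intro indep_vars_sum indep_vars_subset[OF indep]) auto
  moreover have "integrable M (\<lambda>\<omega>. \<Sum>j\<in>J. \<xi> j \<omega>)" "expectation (\<lambda>\<omega>. \<Sum>j\<in>J. \<xi> j \<omega>) = 0"
    using moments by auto
  ultimately have "integrable M (\<lambda>\<omega>. \<xi> i \<omega> * (\<Sum>j\<in>J. \<xi> j \<omega>))"
    "expectation (\<lambda>\<omega>. \<xi> i \<omega> * (\<Sum>j\<in>J. \<xi> j \<omega>)) = 0"
    using indep_var_integrable[of "\<xi> i" "\<lambda>\<omega>. \<Sum>j\<in>J. \<xi> j \<omega>"]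
      indep_var_lebesgue_integral[of "\<xi> i" "\<lambda>\<omega>. \<Sum>j\<in>J. \<xi> j \<omega>"] moments by auto
  moreover have "(\<Sum>j\<in>insert i J. \<xi> j \<omega>)\<^sup>2 =
      (\<xi> i \<omega>)\<^sup>2 + 2 * (\<xi> i \<omega> * (\<Sum>j\<in>J. \<xi> j \<omega>)) + (\<Sum>j\<in>J. \<xi> j \<omega>)\<^sup>2" for \<omega>
    using insert by (simp add: power2_sum)
  ultimately show ?case using insert moments[of i] by simp
qed simp

lemma sum_tail:
  assumes "finite J" "\<kappa> > 0"
  shows "prob {\<omega> \<in> space M. \<bar>\<Sum>j\<in>J. \<xi> j \<omega>\<bar> > \<kappa>} \<le> card J / \<kappa>\<^sup>2"
proof -
  have "prob {\<omega> \<in> space M. \<bar>\<Sum>j\<in>J. \<xi> j \<omega>\<bar> > \<kappa>} \<le> prob {\<omega> \<in> space M. \<bar>\<Sum>j\<in>J. \<xi> j \<omega>\<bar> \<ge> \<kappa>}"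
    by (intro finite_measure_mono) auto
  also have "\<dots> \<le> expectation (\<lambda>\<omega>. (\<Sum>j\<in>J. \<xi> j \<omega>)\<^sup>2) / \<kappa>\<^sup>2"
    using sum_second_moment[OF assms(1)] assms by (intro second_moment_method) auto
  finally show ?thesis using sum_second_moment[OF assms(1)] by simp
qed

lemma large_summand:
  assumes "finite J"
  shows "prob {\<omega> \<in> space M. \<exists>j\<in>J. \<xi> j \<omega> > b} \<le> card J * measure F {b<..}"
proof -
  have "prob {\<omega> \<in> space M. \<exists>j\<in>J. \<xi> j \<omega> > b} = prob (\<Union>j\<in>J. {\<omega> \<in> space M. \<xi> j \<omega> \<in> {b<..}})"
    by (intro arg_cong[of _ _ prob]) auto
  also have "\<dots> \<le> (\<Sum>j\<in>J. prob {\<omega> \<in> space M. \<xi> j \<omega> \<in> {b<..}})"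
    using assms by (intro finite_measure_subadditive_finite) auto
  finally show ?thesis by (subst (asm) prob_F) auto
qed

section \<open>Exponential moments of truncated summands\<close>

definition truncated_mgf :: "real \<Rightarrow> real \<Rightarrow> real" where
  "truncated_mgf b s = (\<integral>t. indicator {..b} t * exp (s * t) \<partial>F)"

lemma truncated_mgf_integrable:
  assumes "s \<ge> 0"
  shows "integrable F (\<lambda>t. indicator {..b} t * exp (s * t))"
proof (rule F.integrable_const_bound[of _ "exp (s * b)"])
  show "AE t in F. norm (indicator {..b} t * exp (s * t)) \<le> exp (s * b)"
    using assms by (auto simp: indicator_def intro!: mult_left_mono)
qed simp

lemma truncated_mgf_nonneg: "truncated_mgf b s \<ge> 0"
  unfolding truncated_mgf_def by (intro integral_nonneg_AE) auto

lemma truncated_mgf_sum: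
  fixes b :: real
  assumes J: "finite J" and "s \<ge> 0"
  defines "Z \<equiv> (\<lambda>\<omega>. (if \<forall>j\<in>J. \<xi> j \<omega> \<le> b then exp (s * (\<Sum>j\<in>J. \<xi> j \<omega>)) else 0))"
  shows "integrable M Z" "expectation Z = truncated_mgf b s ^ card J"
proof -
  define g where "g = (\<lambda>t. indicator {..b} t * exp (s * t))"
  have [measurable]: "g \<in> borel_measurable borel" unfolding g_def by simp
  have Z: "Z = (\<lambda>\<omega>. \<Prod>j\<in>J. g (\<xi> j \<omega>))"
  proof
    fix \<omega>
    show "Z \<omega> = (\<Prod>j\<in>J. g (\<xi> j \<omega>))"
    proof (cases "\<forall>j\<in>J. \<xi> j \<omega> \<le> b")
      case True
      then show ?thesis using J by (simp add: Z_def g_def sum_distrib_left exp_sum)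
    next
      case False
      then show ?thesis using J by (auto simp: Z_def g_def intro!: bexI)
    qed
  qed
  have ind: "indep_vars (\<lambda>_. borel) (\<lambda>j \<omega>. g (\<xi> j \<omega>)) J"
    by (rule indep_vars_compose2[OF indep_vars_subset[OF indep]]) auto
  have int: "integrable M (\<lambda>\<omega>. g (\<xi> j \<omega>))" and ex: "expectation (\<lambda>\<omega>. g (\<xi> j \<omega>)) = truncated_mgf b s" for j
    using truncated_mgf_integrable[OF \<open>s \<ge> 0\<close>, of b] integral_F[of g j]
    by (simp_all add: g_def truncated_mgf_def)
  show "integrable M Z" unfolding Z by (rule indep_vars_integrable[OF J ind int])
  show "expectation Z = truncated_mgf b s ^ card J"
    unfolding Z by (subst indep_vars_lebesgue_integral[OF J ind int]) (simp add: ex)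
qed

lemma truncated_sum_tail:
  assumes J: "finite J" and "s \<ge> 0"
  shows "prob {\<omega> \<in> space M. (\<forall>j\<in>J. \<xi> j \<omega> \<le> b) \<and> (\<Sum>j\<in>J. \<xi> j \<omega>) > y}
    \<le> truncated_mgf b s ^ card J * exp (- s * y)"
proof -
  define Z where "Z = (\<lambda>\<omega>. (if \<forall>j\<in>J. \<xi> j \<omega> \<le> b then exp (s * (\<Sum>j\<in>J. \<xi> j \<omega>)) else 0))"
  define B where "B = {\<omega> \<in> space M. (\<forall>j\<in>J. \<xi> j \<omega> \<le> b) \<and> (\<Sum>j\<in>J. \<xi> j \<omega>) > y}"
  have B: "B \<in> events" unfolding B_def using J by measurable
  have "prob B = expectation (indicator B)" using B by simp
  also have "\<dots> \<le> expectation (\<lambda>\<omega>. Z \<omega> * exp (- s * y))"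
  proof (rule integral_mono)
    show "integrable M (\<lambda>\<omega>. Z \<omega> * exp (- s * y))"
      using truncated_mgf_sum[OF assms] by (simp add: Z_def)
    fix \<omega> assume "\<omega> \<in> space M"
    show "indicator B \<omega> \<le> Z \<omega> * exp (- s * y)"
    proof (cases "\<omega> \<in> B")
      case True
      then have "s * y \<le> s * (\<Sum>j\<in>J. \<xi> j \<omega>)" using \<open>s \<ge> 0\<close> by (intro mult_left_mono) (auto simp: B_def)
      then show ?thesis using True by (simp add: B_def Z_def flip: exp_add)
    qed (auto simp: Z_def)
  qed (use B in \<open>auto simp: less_top[symmetric]\<close>)
  also have "\<dots> = truncated_mgf b s ^ card J * exp (- s * y)"
    using truncated_mgf_sum[OF assms] by (simp add: Z_def)
  finally show ?thesis unfolding B_def .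
qed

text \<open>The event involves each of the other summands as well as their sum, so
  \<open>\<xi> i\<close> is separated from the whole vector indexed by \<open>J\<close>. The set
  \<open>K\<close> is \<open>UNIV\<close> for the upper bound and an interval around 0 for the lower
  one.\<close>

lemma section_rest:
  fixes b :: real
  assumes J: "finite J" "i \<notin> J" and D: "D \<in> sets borel" and K: "K \<in> sets borel"
  defines "h \<equiv> (\<lambda>\<omega>. measure F {a. b < a \<and> (\<forall>j\<in>J. \<xi> j \<omega> \<le> b) \<and> (\<Sum>j\<in>J. \<xi> j \<omega>) \<in> K \<and>
      a + (\<Sum>j\<in>J. \<xi> j \<omega>) \<in> D})"
  shows "integrable M h"
    and "prob {\<omega> \<in> space M. b < \<xi> i \<omega> \<and> (\<forall>j\<in>J. \<xi> j \<omega> \<le> b) \<and> (\<Sum>j\<in>J. \<xi> j \<omega>) \<in> K \<and>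
      \<xi> i \<omega> + (\<Sum>j\<in>J. \<xi> j \<omega>) \<in> D} = expectation h"
proof -
  note [measurable] = D K
  define P :: "real \<Rightarrow> (nat \<Rightarrow> real) \<Rightarrow> bool" where
    "P = (\<lambda>a f. b < a \<and> (\<forall>j\<in>J. f j \<le> b) \<and> (\<Sum>j\<in>J. f j) \<in> K \<and> a + (\<Sum>j\<in>J. f j) \<in> D)"
  let ?N = "PiM {i} (\<lambda>_. borel) :: (nat \<Rightarrow> real) measure"
  let ?L = "PiM J (\<lambda>_. borel) :: (nat \<Rightarrow> real) measure"
  have ind: "indep_var ?N (\<lambda>\<omega>. restrict (\<lambda>j. \<xi> j \<omega>) {i}) ?L (\<lambda>\<omega>. restrict (\<lambda>j. \<xi> j \<omega>) J)"
    using J by (intro indep_var_restrict[OF indep]) auto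
  have meas: "Measurable.pred (?N \<Otimes>\<^sub>M ?L) (\<lambda>w. P (fst w i) (snd w))"
    unfolding P_def using J(1) by measurable
  note sec = indep_var_section[OF ind, of "\<lambda>a. P (a i)", OF meas]
  have P_eq: "P a (\<lambda>j\<in>J. \<xi> j \<omega>) \<longleftrightarrow> b < a \<and> (\<forall>j\<in>J. \<xi> j \<omega> \<le> b) \<and> (\<Sum>j\<in>J. \<xi> j \<omega>) \<in> K \<and>
      a + (\<Sum>j\<in>J. \<xi> j \<omega>) \<in> D" for a \<omega>
    by (simp add: P_def)
  have R: "(\<lambda>\<omega>. restrict (\<lambda>j. \<xi> j \<omega>) {i}) \<in> measurable M ?N"
    by (intro measurable_restrict) auto
  have "distr (distr M ?N (\<lambda>\<omega>. restrict (\<lambda>j. \<xi> j \<omega>) {i})) borel (\<lambda>a. a i) = F"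
    using R by (subst distr_distr) (auto simp: comp_def distr_eq)
  then have "measure (distr M ?N (\<lambda>\<omega>. restrict (\<lambda>j. \<xi> j \<omega>) {i})) {a \<in> space ?N. a i \<in> A} = measure F A"
    if "A \<in> sets borel" for A
    using that by (auto simp: measure_distr vimage_def Int_def conj_commute)
  note slice = this[of "{a. _ a}", unfolded mem_Collect_eq]
  have h: "measure (distr M ?N (\<lambda>\<omega>. restrict (\<lambda>j. \<xi> j \<omega>) {i})) {a \<in> space ?N. P (a i) (\<lambda>j\<in>J. \<xi> j \<omega>)} = h \<omega>" for \<omega>
    unfolding h_def P_eq by (rule slice) measurable
  show "integrable M h" using sec(1) unfolding h .
  show "prob {\<omega> \<in> space M. b < \<xi> i \<omega> \<and> (\<forall>j\<in>J. \<xi> j \<omega> \<le> b) \<and> (\<Sum>j\<in>J. \<xi> j \<omega>) \<in> K \<and>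
      \<xi> i \<omega> + (\<Sum>j\<in>J. \<xi> j \<omega>) \<in> D} = expectation h"
    using sec(2) unfolding h by (simp add: P_def)
qed

lemma typical_rest:
  assumes J: "finite J" and "\<kappa> > 0"
  shows "prob {\<omega> \<in> space M. (\<forall>j\<in>J. \<xi> j \<omega> \<le> b) \<and> \<bar>\<Sum>j\<in>J. \<xi> j \<omega>\<bar> \<le> \<kappa>}
    \<ge> 1 - (card J / \<kappa>\<^sup>2 + card J * measure F {b<..})"
proof -
  define A where "A = {\<omega> \<in> space M. (\<forall>j\<in>J. \<xi> j \<omega> \<le> b) \<and> \<bar>\<Sum>j\<in>J. \<xi> j \<omega>\<bar> \<le> \<kappa>}"
  define B where "B = {\<omega> \<in> space M. \<bar>\<Sum>j\<in>J. \<xi> j \<omega>\<bar> > \<kappa>}"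
  define C where "C = {\<omega> \<in> space M. \<exists>j\<in>J. \<xi> j \<omega> > b}"
  have m: "A \<in> events" "B \<in> events" "C \<in> events"
    unfolding A_def B_def C_def using J by measurable
  have "1 - prob A = prob (space M - A)" using m by (simp add: prob_compl)
  also have "space M - A = B \<union> C" by (auto simp: A_def B_def C_def not_le)
  also have "prob (B \<union> C) \<le> prob B + prob C" using m by (intro measure_Un_le)
  also have "\<dots> \<le> card J / \<kappa>\<^sup>2 + card J * measure F {b<..}"
    using sum_tail[OF assms] large_summand[OF J, of b] by (simp add: B_def C_def)
  finally show ?thesis by (simp add: A_def)
qed

end

lemma exp_le_quadratic:
  fixes u :: real
  assumes "u \<le> 1"
  shows "exp u \<le> 1 + u + u\<^sup>2"
proof (cases "u \<ge> 0")
  case True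
  then show ?thesis using exp_bound[of u] assms by simp
next
  case False
  define v where "v = - u"
  have v: "v > 0" using False by (simp add: v_def)
  \<comment> \<open>The product equals \<open>1 + v^3\<close>; together with
    \<open>1 + v \<le> exp v\<close> this bounds \<open>exp (- v)\<close>.\<close>
  have "1 \<le> (1 + v) * (1 - v + v\<^sup>2)"
    using v by (simp add: power2_eq_square algebra_simps)
  also have "\<dots> \<le> exp v * (1 - v + v\<^sup>2)"
  proof (rule mult_right_mono)
    have "0 \<le> (1 - v / 2)\<^sup>2 + 3 / 4 * v\<^sup>2" by simp
    then show "0 \<le> 1 - v + v\<^sup>2" by (simp add: power2_eq_square algebra_simps)
  qed (rule exp_ge_add_one_self)
  finally have "exp (- v) * 1 \<le> exp (- v) * (exp v * (1 - v + v\<^sup>2))" by (intro mult_left_mono) auto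
  also have "\<dots> = 1 - v + v\<^sup>2" by (simp add: exp_minus)
  finally show ?thesis by (simp add: v_def)
qed

context standardized_iid
begin

text \<open>Up to \<open>1 / s\<close> the exponential is bounded quadratically, and from there to
  \<open>b\<close> by \<open>\<rho> * h\<close>. Integration removes the linear term since the mean
  is 0. The bound is written as an exponential so that powers of it are easy to take.\<close>

lemma truncated_mgf_le:
  assumes s: "s > 0" and \<rho>: "\<rho> \<ge> 0"
    and h: "integrable F h" "\<And>t. 0 \<le> h t" "\<And>t. 1 / s < t \<Longrightarrow> t \<le> b \<Longrightarrow> exp (s * t) \<le> \<rho> * h t"
  shows "truncated_mgf b s \<le> exp (s\<^sup>2 + \<rho> * (\<integral>t. h t \<partial>F))"
proof -
  have "truncated_mgf b s \<le> (\<integral>t. 1 + s * t + s\<^sup>2 * t\<^sup>2 + \<rho> * h t \<partial>F)"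
    unfolding truncated_mgf_def
  proof (rule integral_mono)
    show "integrable F (\<lambda>t. indicator {..b} t * exp (s * t))"
      using s by (intro truncated_mgf_integrable) simp
    show "integrable F (\<lambda>t. 1 + s * t + s\<^sup>2 * t\<^sup>2 + \<rho> * h t)"
      using moments_F h by auto
    fix t
    \<comment> \<open>As \<open>1 + u + u^2\<close> is positive everywhere, the quadratic may be
      kept beyond \<open>1 / s\<close> and beyond \<open>b\<close>, so the full moments of
      \<open>F\<close> apply.\<close>
    have "0 \<le> (1 + s * t / 2)\<^sup>2 + 3 / 4 * (s * t)\<^sup>2" by simp
    then have pos: "0 \<le> 1 + s * t + s\<^sup>2 * t\<^sup>2" by (simp add: power2_eq_square algebra_simps)
    have "0 \<le> \<rho> * h t" using \<rho> h by simp
    show "indicator {..b} t * exp (s * t) \<le> 1 + s * t + s\<^sup>2 * t\<^sup>2 + \<rho> * h t"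
    proof (cases "t \<le> b")
      case False
      then show ?thesis using pos \<open>0 \<le> \<rho> * h t\<close> by simp
    next
      case True
      show ?thesis
      proof (cases "1 / s < t")
        case True
        then show ?thesis using h(3)[OF True \<open>t \<le> b\<close>] pos \<open>t \<le> b\<close> by simp
      next
        case False
        then have "s * t \<le> 1" using s by (simp add: field_simps)
        then have "exp (s * t) \<le> 1 + s * t + (s * t)\<^sup>2"
          by (rule exp_le_quadratic)
        then show ?thesis using \<open>0 \<le> \<rho> * h t\<close> \<open>t \<le> b\<close> by (simp add: power_mult_distrib)
      qed
    qed
  qed
  also have "\<dots> = 1 + (s\<^sup>2 + \<rho> * (\<integral>t. h t \<partial>F))"
    using moments_F h F.prob_space by simp
  also have "\<dots> \<le> exp (s\<^sup>2 + \<rho> * (\<integral>t. h t \<partial>F))" by (rule exp_ge_add_one_self)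
  finally show ?thesis .
qed

text \<open>Given the other summands, the probability is bounded pointwise according to their sum
  \<open>W\<close>. A sum above \<open>b\<close> of summands below \<open>b\<close> is paid for
  exponentially, a sum within \<open>\<kappa>\<close> by \<open>u\<close>, and any other sum by
  \<open>v\<close> times what the typical sums leave of the exponential moment.\<close>

lemma big_jump_upper:
  assumes J: "finite J" "i \<notin> J" and D: "D \<in> sets borel"
    and s: "s \<ge> 0" and \<kappa>: "\<kappa> > 0" "\<kappa> \<le> b" and uv: "0 \<le> u" "0 \<le> v"
    and near: "\<And>z. \<bar>z\<bar> \<le> \<kappa> \<Longrightarrow> measure F {a. a - (x - z) \<in> D} \<le> u"
    and far: "\<And>z. z \<le> b \<Longrightarrow> measure F {a. a - (x - z) \<in> D} \<le> v * exp (s * max z 0)"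
  shows "prob {\<omega> \<in> space M. b < \<xi> i \<omega> \<and> (\<forall>j\<in>J. \<xi> j \<omega> \<le> b) \<and> \<xi> i \<omega> + (\<Sum>j\<in>J. \<xi> j \<omega>) - x \<in> D}
    \<le> measure F {b<..} * (truncated_mgf b s ^ card J * exp (- s * b)) + u +
      v * (truncated_mgf b s ^ card J - exp (- s * \<kappa>) * (1 - (card J / \<kappa>\<^sup>2 + card J * measure F {b<..}))
        + card J / \<kappa>\<^sup>2)"
proof -
  note [measurable] = D
  define W where "W = (\<lambda>\<omega>. \<Sum>j\<in>J. \<xi> j \<omega>)"
  define small where "small = (\<lambda>\<omega>. \<forall>j\<in>J. \<xi> j \<omega> \<le> b)"
  define Z where "Z = (\<lambda>\<omega>. if small \<omega> then exp (s * W \<omega>) else 0)"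
  define A where "A = {\<omega> \<in> space M. small \<omega> \<and> \<bar>W \<omega>\<bar> \<le> \<kappa>}"
  define B where "B = {\<omega> \<in> space M. \<bar>W \<omega>\<bar> > \<kappa>}"
  define h where "h = (\<lambda>\<omega>. measure F {a. b < a \<and> small \<omega> \<and> W \<omega> \<in> UNIV \<and> a + W \<omega> \<in> {t. t - x \<in> D}})"
  have D': "{t. t - x \<in> D} \<in> sets borel" by measurable
  have AB: "A \<in> events" "B \<in> events"
    unfolding A_def B_def small_def W_def using J by measurable
  have Z: "integrable M Z" "expectation Z = truncated_mgf b s ^ card J"
    using truncated_mgf_sum[OF J(1) s, of b] unfolding Z_def small_def W_def by blast+
  define G where "G = measure F {b<..}"
  have G: "G \<ge> 0" by (simp add: G_def)
  have "prob {\<omega> \<in> space M. b < \<xi> i \<omega> \<and> small \<omega> \<and> \<xi> i \<omega> + W \<omega> - x \<in> D} = expectation h"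
    and h_int: "integrable M h"
    using section_rest[OF J D', of UNIV b] by (simp_all add: h_def small_def W_def)
  then have "prob {\<omega> \<in> space M. b < \<xi> i \<omega> \<and> small \<omega> \<and> \<xi> i \<omega> + W \<omega> - x \<in> D} = expectation h" by simp
  also have "\<dots> \<le> expectation (\<lambda>\<omega>. G * (Z \<omega> * exp (- s * b)) + u
        + v * (Z \<omega> - exp (- s * \<kappa>) * indicator A \<omega> + indicator B \<omega>))"
  proof (rule integral_mono[OF h_int])
    show "integrable M (\<lambda>\<omega>. G * (Z \<omega> * exp (- s * b)) + u
        + v * (Z \<omega> - exp (- s * \<kappa>) * indicator A \<omega> + indicator B \<omega>))"
      using Z AB by (auto simp: less_top[symmetric])
    fix \<omega> assume \<omega>: "\<omega> \<in> space M"
    have Zpos: "Z \<omega> \<ge> 0" by (simp add: Z_def)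
    \<comment> \<open>On \<open>A\<close> the exponential \<open>Z\<close> is at least
      \<open>exp (- s * \<kappa>)\<close>. Subtracting this keeps the term nonnegative and can bring
      its mean from near 1 to near 0, while off \<open>A\<close>, where the term is needed, nothing
      is lost.\<close>
    have third: "0 \<le> Z \<omega> - exp (- s * \<kappa>) * indicator A \<omega>"
    proof (cases "\<omega> \<in> A")
      case True
      then have "s * (- \<kappa>) \<le> s * W \<omega>" using s by (intro mult_left_mono) (auto simp: A_def)
      then show ?thesis using True by (simp add: A_def Z_def)
    qed (use Zpos in simp)
    have Bpos: "(0::real) \<le> indicator B \<omega>" by simp
    have t1: "0 \<le> G * (Z \<omega> * exp (- s * b))" using G Zpos by simp
    have t3: "0 \<le> v * (Z \<omega> - exp (- s * \<kappa>) * indicator A \<omega> + indicator B \<omega>)"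
      using third Bpos uv by (intro mult_nonneg_nonneg) auto
    have h_le: "h \<omega> \<le> measure F {a. a - (x - W \<omega>) \<in> D}"
      unfolding h_def by (intro F.finite_measure_mono) (auto simp: algebra_simps)
    show "h \<omega> \<le> G * (Z \<omega> * exp (- s * b)) + u
        + v * (Z \<omega> - exp (- s * \<kappa>) * indicator A \<omega> + indicator B \<omega>)"
    proof (cases "small \<omega>")
      case False
      then have "h \<omega> = 0" by (simp add: h_def)
      then show ?thesis using t1 t3 uv by simp
    next
      case small: True
      consider "W \<omega> > b" | "\<bar>W \<omega>\<bar> \<le> \<kappa>" | "W \<omega> \<le> b" "\<bar>W \<omega>\<bar> > \<kappa>" by linarith
      then show ?thesis
      proof cases
        case 1
        have "s * b \<le> s * W \<omega>" using 1 s by (intro mult_left_mono) auto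
        then have "1 \<le> Z \<omega> * exp (- s * b)" using small by (simp add: Z_def flip: exp_add)
        then have "G * 1 \<le> G * (Z \<omega> * exp (- s * b))" using G by (intro mult_left_mono)
        moreover have "h \<omega> \<le> G" unfolding h_def G_def by (intro F.finite_measure_mono) auto
        ultimately show ?thesis using t3 uv by simp
      next
        case 2
        then show ?thesis using h_le near[OF 2] t1 t3 by simp
      next
        case 3
        have ind: "\<omega> \<notin> A" "\<omega> \<in> B" using 3 \<omega> by (auto simp: A_def B_def)
        \<comment> \<open>For negative \<open>W\<close> the left side is 1 while \<open>Z\<close>
          may be tiny; the extra 1 is supplied by \<open>indicator B\<close>.\<close>
        have "exp (s * max (W \<omega>) 0) \<le> Z \<omega> + 1"
          using small by (cases "W \<omega> \<ge> 0") (auto simp: Z_def)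
        then have "v * exp (s * max (W \<omega>) 0) \<le> v * (Z \<omega> + 1)" using uv by (intro mult_left_mono)
        then show ?thesis using h_le far[OF 3(1)] ind t1 uv by simp
      qed
    qed
  qed
  also have "\<dots> = G * (truncated_mgf b s ^ card J * exp (- s * b)) + u
      + v * (truncated_mgf b s ^ card J - exp (- s * \<kappa>) * prob A + prob B)"
    using Z AB by (simp add: prob_space less_top[symmetric])
  also have "\<dots> \<le> G * (truncated_mgf b s ^ card J * exp (- s * b)) + u
      + v * (truncated_mgf b s ^ card J - exp (- s * \<kappa>) * (1 - (card J / \<kappa>\<^sup>2 + card J * G)) + card J / \<kappa>\<^sup>2)"
    using typical_rest[OF J(1) \<kappa>(1), of b] sum_tail[OF J(1) \<kappa>(1)] uv
    by (intro add_mono order_refl mult_left_mono diff_mono) (auto simp: A_def B_def small_def W_def G_def)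
  finally show ?thesis by (simp add: small_def W_def G_def)
qed

lemma big_jump_lower:
  assumes J: "finite J" "i \<notin> J" and D: "D \<in> sets borel" "D \<subseteq> {0<..}"
    and \<kappa>: "\<kappa> > 0" "b + \<kappa> \<le> x" and l: "0 \<le> l"
    and near: "\<And>z. \<bar>z\<bar> \<le> \<kappa> \<Longrightarrow> l \<le> measure F {a. a - (x - z) \<in> D}"
  shows "l * (1 - (card J / \<kappa>\<^sup>2 + card J * measure F {b<..})) \<le>
    prob {\<omega> \<in> space M. b < \<xi> i \<omega> \<and> (\<forall>j\<in>J. \<xi> j \<omega> \<le> b) \<and> \<xi> i \<omega> + (\<Sum>j\<in>J. \<xi> j \<omega>) - x \<in> D}"
proof -
  note [measurable] = D(1)
  define W where "W = (\<lambda>\<omega>. \<Sum>j\<in>J. \<xi> j \<omega>)"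
  define small where "small = (\<lambda>\<omega>. \<forall>j\<in>J. \<xi> j \<omega> \<le> b)"
  define A where "A = {\<omega> \<in> space M. small \<omega> \<and> \<bar>W \<omega>\<bar> \<le> \<kappa>}"
  define h where "h = (\<lambda>\<omega>. measure F {a. b < a \<and> small \<omega> \<and> W \<omega> \<in> {-\<kappa>..\<kappa>} \<and> a + W \<omega> \<in> {t. t - x \<in> D}})"
  have D': "{t. t - x \<in> D} \<in> sets borel" by measurable
  have A: "A \<in> events" unfolding A_def small_def W_def using J by measurable
  have sec: "prob {\<omega> \<in> space M. b < \<xi> i \<omega> \<and> small \<omega> \<and> W \<omega> \<in> {-\<kappa>..\<kappa>} \<and> \<xi> i \<omega> + W \<omega> \<in> {t. t - x \<in> D}} = expectation h"
    and h_int: "integrable M h"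
    using section_rest[OF J D', of "{-\<kappa>..\<kappa>}" b] by (simp_all add: h_def small_def W_def)
  have "l * (1 - (card J / \<kappa>\<^sup>2 + card J * measure F {b<..})) \<le> l * prob A"
    using typical_rest[OF J(1) \<kappa>(1), of b] l by (intro mult_left_mono) (auto simp: A_def small_def W_def)
  also have "\<dots> = expectation (\<lambda>\<omega>. l * indicator A \<omega>)" using A by simp
  also have "\<dots> \<le> expectation h"
  proof (rule integral_mono)
    show "integrable M (\<lambda>\<omega>. l * indicator A \<omega>)" using A by (auto simp: less_top[symmetric])
    fix \<omega> assume "\<omega> \<in> space M"
    show "l * indicator A \<omega> \<le> h \<omega>"
    proof (cases "\<omega> \<in> A")
      case True
      then have W: "\<bar>W \<omega>\<bar> \<le> \<kappa>" "small \<omega>" by (auto simp: A_def)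
      have "{a. a - (x - W \<omega>) \<in> D} \<subseteq>
          {a. b < a \<and> small \<omega> \<and> W \<omega> \<in> {-\<kappa>..\<kappa>} \<and> a + W \<omega> \<in> {t. t - x \<in> D}}"
      proof
        fix a assume "a \<in> {a. a - (x - W \<omega>) \<in> D}"
        then have a: "a - (x - W \<omega>) \<in> D" by simp
        \<comment> \<open>Because \<open>D\<close> contains only positive numbers,
          \<open>a > x - W \<omega> \<ge> x - \<kappa> \<ge> b\<close>: the jump exceeds
          \<open>b\<close> automatically.\<close>
        then have "a - (x - W \<omega>) > 0" using D by auto
        then show "a \<in> {a. b < a \<and> small \<omega> \<and> W \<omega> \<in> {-\<kappa>..\<kappa>} \<and> a + W \<omega> \<in> {t. t - x \<in> D}}"
          using W \<kappa> a by (auto simp: algebra_simps)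
      qed
      then have "measure F {a. a - (x - W \<omega>) \<in> D} \<le> h \<omega>"
        unfolding h_def using W by (intro F.finite_measure_mono) auto
      then show ?thesis using near[OF W(1)] True by simp
    qed (simp add: h_def)
  qed (rule h_int)
  also have "\<dots> \<le> prob {\<omega> \<in> space M. b < \<xi> i \<omega> \<and> small \<omega> \<and> \<xi> i \<omega> + W \<omega> - x \<in> D}"
    unfolding sec[symmetric]
    by (intro finite_measure_mono) (use J in \<open>auto simp: small_def W_def\<close>)
  finally show ?thesis by (simp add: small_def W_def)
qed

lemma two_large_summands:
  assumes "i \<noteq> j"
  shows "prob {\<omega> \<in> space M. b < \<xi> i \<omega> \<and> b < \<xi> j \<omega>} = (measure F {b<..})\<^sup>2"
proof -
  have "prob (\<Inter>k\<in>{i, j}. \<xi> k -` {b<..} \<inter> space M) = (\<Prod>k\<in>{i, j}. prob (\<xi> k -` {b<..} \<inter> space M))"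
    by (rule indep_varsD[OF indep]) auto
  also have "(\<Inter>k\<in>{i, j}. \<xi> k -` {b<..} \<inter> space M) = {\<omega> \<in> space M. b < \<xi> i \<omega> \<and> b < \<xi> j \<omega>}" by auto
  also have "(\<Prod>k\<in>{i, j}. prob (\<xi> k -` {b<..} \<inter> space M)) = (\<Prod>k\<in>{i, j}. measure F {b<..})"
  proof (intro prod.cong refl)
    fix k
    have "\<xi> k -` {b<..} \<inter> space M = {\<omega> \<in> space M. \<xi> k \<omega> \<in> {b<..}}" by auto
    then show "prob (\<xi> k -` {b<..} \<inter> space M) = measure F {b<..}"
      using prob_F[of "{b<..}" k] by simp
  qed
  finally show ?thesis using assms by (simp add: power2_eq_square)
qed

text \<open>The cases are that no summand exceeds \<open>b\<close> (\<open>E0\<close>), exactly one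
  does (\<open>E1\<close>), or at least two do (\<open>E2\<close>). The quantities
  \<open>\<Phi>\<close>, \<open>G\<close> and \<open>\<eta>\<close> enter as variables with defining
  equations so that they can be matched with functions of \<open>n\<close> and
  \<open>x\<close>.\<close>

lemma sum_local_upper:
  fixes n :: nat and G \<eta> \<Phi> r :: real
  assumes D: "D \<in> sets borel" "D \<subseteq> {0<..}"
    and s: "s \<ge> 0" and \<kappa>: "\<kappa> > 0" "\<kappa> \<le> b" and uv: "0 \<le> u" "0 \<le> v"
    and near: "\<And>z. \<bar>z\<bar> \<le> \<kappa> \<Longrightarrow> measure F {a. a - (x - z) \<in> D} \<le> u"
    and far: "\<And>z. z \<le> b \<Longrightarrow> measure F {a. a - (x - z) \<in> D} \<le> v * exp (s * max z 0)"
    and mgf: "truncated_mgf b s \<le> exp r" "r \<ge> 0"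
    and \<Phi>: "\<Phi> = exp (n * r)" and G: "G = measure F {b<..}" and \<eta>: "\<eta> = n / \<kappa>\<^sup>2 + n * G"
  shows "prob {\<omega> \<in> space M. (\<Sum>i=1..n. \<xi> i \<omega>) - x \<in> D}
    \<le> \<Phi> * exp (- s * x) + (n * G)\<^sup>2 + n * (G * (\<Phi> * exp (- s * b)) + u + v * (\<Phi> - exp (- s * \<kappa>) * (1 - \<eta>) + \<eta>))"
proof -
  note [measurable] = D(1)
  let ?I = "{1..n}"
  define E0 where "E0 = {\<omega> \<in> space M. (\<forall>j\<in>?I. \<xi> j \<omega> \<le> b) \<and> (\<Sum>j\<in>?I. \<xi> j \<omega>) > x}"
  define E1 where "E1 = (\<lambda>i. {\<omega> \<in> space M. b < \<xi> i \<omega> \<and> (\<forall>j\<in>?I - {i}. \<xi> j \<omega> \<le> b) \<and>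
      \<xi> i \<omega> + (\<Sum>j\<in>?I - {i}. \<xi> j \<omega>) - x \<in> D})"
  define E2 where "E2 = (\<lambda>(i, j). {\<omega> \<in> space M. b < \<xi> i \<omega> \<and> b < \<xi> j \<omega>})"
  define PP where "PP = {(i, j) \<in> ?I \<times> ?I. i \<noteq> j}"
  have fin: "finite PP" unfolding PP_def by (rule finite_subset[of _ "?I \<times> ?I"]) auto
  have ev: "E0 \<in> events" "\<And>i. E1 i \<in> events" "\<And>ij. E2 ij \<in> events"
    unfolding E0_def E1_def E2_def by (auto split: prod.split)
  have G0: "G \<ge> 0" by (simp add: G)
  \<comment> \<open>As \<open>r \<ge> 0\<close>, one constant serves for the \<open>n\<close>
    summands in \<open>E0\<close> and for the \<open>n - 1\<close> others in
    \<open>E1\<close>.\<close>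
  have pow: "truncated_mgf b s ^ k \<le> \<Phi>" if "k \<le> n" for k
  proof -
    have "truncated_mgf b s ^ k \<le> exp r ^ k" using mgf truncated_mgf_nonneg by (intro power_mono)
    also have "\<dots> = exp (k * r)" by (simp add: exp_of_nat_mult)
    also have "\<dots> \<le> \<Phi>" unfolding \<Phi> using that mgf by (simp add: mult_right_mono)
    finally show ?thesis .
  qed
  have cover: "{\<omega> \<in> space M. (\<Sum>i=1..n. \<xi> i \<omega>) - x \<in> D} \<subseteq> E0 \<union> (\<Union>ij\<in>PP. E2 ij) \<union> (\<Union>i\<in>?I. E1 i)"
  proof
    fix \<omega> assume "\<omega> \<in> {\<omega> \<in> space M. (\<Sum>i=1..n. \<xi> i \<omega>) - x \<in> D}"
    then have \<omega>: "\<omega> \<in> space M" "(\<Sum>i\<in>?I. \<xi> i \<omega>) - x \<in> D" by auto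
    then have gt: "(\<Sum>i\<in>?I. \<xi> i \<omega>) > x" using D by auto
    show "\<omega> \<in> E0 \<union> (\<Union>ij\<in>PP. E2 ij) \<union> (\<Union>i\<in>?I. E1 i)"
    proof (cases "\<forall>j\<in>?I. \<xi> j \<omega> \<le> b")
      case True
      then show ?thesis using gt \<omega> by (auto simp: E0_def)
    next
      case False
      then obtain i where i: "i \<in> ?I" "b < \<xi> i \<omega>" by (auto simp: not_le)
      show ?thesis
      proof (cases "\<forall>j\<in>?I - {i}. \<xi> j \<omega> \<le> b")
        case True
        have "(\<Sum>i\<in>?I. \<xi> i \<omega>) = \<xi> i \<omega> + (\<Sum>j\<in>?I - {i}. \<xi> j \<omega>)"
          using i by (intro sum.remove) auto
        then have "\<omega> \<in> E1 i" using True i \<omega> by (auto simp: E1_def)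
        then show ?thesis using i by blast
      next
        case False
        then obtain j where j: "j \<in> ?I" "j \<noteq> i" "b < \<xi> j \<omega>"
          unfolding Ball_def not_all not_imp not_le by blast
        then have "(i, j) \<in> PP" "\<omega> \<in> E2 (i, j)" using i \<omega> by (auto simp: PP_def E2_def)
        then show ?thesis by blast
      qed
    qed
  qed
  have "prob {\<omega> \<in> space M. (\<Sum>i=1..n. \<xi> i \<omega>) - x \<in> D} \<le> prob (E0 \<union> (\<Union>ij\<in>PP. E2 ij) \<union> (\<Union>i\<in>?I. E1 i))"
    using cover ev fin by (intro finite_measure_mono) auto
  also have "\<dots> \<le> prob E0 + prob (\<Union>ij\<in>PP. E2 ij) + prob (\<Union>i\<in>?I. E1 i)"
    using ev fin measure_Un_le[of E0 M "\<Union>ij\<in>PP. E2 ij"]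
      measure_Un_le[of "E0 \<union> (\<Union>ij\<in>PP. E2 ij)" M "\<Union>i\<in>?I. E1 i"]
    by (simp add: sets.finite_UN)
  also have "\<dots> \<le> \<Phi> * exp (- s * x) + (n * G)\<^sup>2 +
      n * (G * (\<Phi> * exp (- s * b)) + u + v * (\<Phi> - exp (- s * \<kappa>) * (1 - \<eta>) + \<eta>))"
  proof (intro add_mono)
    have "prob E0 \<le> truncated_mgf b s ^ n * exp (- s * x)"
      using truncated_sum_tail[of ?I s b x] s by (simp add: E0_def)
    also have "\<dots> \<le> \<Phi> * exp (- s * x)" using pow by (intro mult_right_mono) auto
    finally show "prob E0 \<le> \<Phi> * exp (- s * x)" .
    have "prob (\<Union>ij\<in>PP. E2 ij) \<le> (\<Sum>ij\<in>PP. prob (E2 ij))"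
      using ev fin by (intro finite_measure_subadditive_finite) auto
    also have "\<dots> = (\<Sum>ij\<in>PP. G\<^sup>2)"
      by (intro sum.cong) (auto simp: PP_def E2_def G two_large_summands)
    also have "\<dots> = card PP * G\<^sup>2" by simp
    also have "\<dots> \<le> card (?I \<times> ?I) * G\<^sup>2"
      by (intro mult_right_mono of_nat_mono card_mono) (auto simp: PP_def)
    finally show "prob (\<Union>ij\<in>PP. E2 ij) \<le> (n * G)\<^sup>2" by (simp add: power2_eq_square mult_ac)
    have "prob (\<Union>i\<in>?I. E1 i) \<le> (\<Sum>i\<in>?I. prob (E1 i))"
      using ev by (intro finite_measure_subadditive_finite) auto
    also have "\<dots> \<le> (\<Sum>i\<in>?I. G * (\<Phi> * exp (- s * b)) + u + v * (\<Phi> - exp (- s * \<kappa>) * (1 - \<eta>) + \<eta>))"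
    proof (rule sum_mono)
      fix i assume i: "i \<in> ?I"
      define c where "c = real (card (?I - {i}))"
      have c: "c \<le> n" "0 \<le> c" using card_mono[of ?I "?I - {i}"] by (auto simp: c_def)
      have "prob (E1 i) \<le> G * (truncated_mgf b s ^ card (?I - {i}) * exp (- s * b)) + u +
          v * (truncated_mgf b s ^ card (?I - {i}) - exp (- s * \<kappa>) * (1 - (c / \<kappa>\<^sup>2 + c * G)) + c / \<kappa>\<^sup>2)"
        unfolding E1_def G c_def
        by (rule big_jump_upper[OF _ _ D(1) s \<kappa> uv near far]) auto
      also have "\<dots> \<le> G * (\<Phi> * exp (- s * b)) + u + v * (\<Phi> - exp (- s * \<kappa>) * (1 - \<eta>) + \<eta>)"
      proof -
        have ck: "c / \<kappa>\<^sup>2 \<le> n / \<kappa>\<^sup>2" "c * G \<le> n * G" "0 \<le> n * G"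
          using c G0 by (auto intro: divide_right_mono mult_right_mono)
        have m: "truncated_mgf b s ^ card (?I - {i}) \<le> \<Phi>" using c by (intro pow) (simp add: c_def)
        have "c / \<kappa>\<^sup>2 \<le> \<eta>" "c / \<kappa>\<^sup>2 + c * G \<le> \<eta>" using ck unfolding \<eta> by linarith+
        then show ?thesis
          using m uv G0
          by (intro add_mono mult_left_mono diff_mono mult_right_mono order_refl) auto
      qed
      finally show "prob (E1 i) \<le> G * (\<Phi> * exp (- s * b)) + u + v * (\<Phi> - exp (- s * \<kappa>) * (1 - \<eta>) + \<eta>)" .
    qed
    also have "\<dots> = n * (G * (\<Phi> * exp (- s * b)) + u + v * (\<Phi> - exp (- s * \<kappa>) * (1 - \<eta>) + \<eta>))" by simp
    finally show "prob (\<Union>i\<in>?I. E1 i) \<le> n * (G * (\<Phi> * exp (- s * b)) + u + v * (\<Phi> - exp (- s * \<kappa>) * (1 - \<eta>) + \<eta>))" .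
  qed
  finally show ?thesis .
qed

text \<open>On \<open>E1 i\<close> the only summand above \<open>b\<close> is
  \<open>\<xi> i\<close>, so these events are disjoint and their probabilities add up without an
  inclusion-exclusion correction.\<close>

lemma sum_local_lower:
  fixes n :: nat and G \<eta> l :: real
  assumes D: "D \<in> sets borel" "D \<subseteq> {0<..}"
    and \<kappa>: "\<kappa> > 0" "b + \<kappa> \<le> x" and l: "0 \<le> l"
    and near: "\<And>z. \<bar>z\<bar> \<le> \<kappa> \<Longrightarrow> l \<le> measure F {a. a - (x - z) \<in> D}"
    and G: "G = measure F {b<..}" and \<eta>: "\<eta> = n / \<kappa>\<^sup>2 + n * G"
  shows "n * (l * (1 - \<eta>)) \<le> prob {\<omega> \<in> space M. (\<Sum>i=1..n. \<xi> i \<omega>) - x \<in> D}"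
proof -
  note [measurable] = D(1)
  let ?I = "{1..n}"
  define E1 where "E1 = (\<lambda>i. {\<omega> \<in> space M. b < \<xi> i \<omega> \<and> (\<forall>j\<in>?I - {i}. \<xi> j \<omega> \<le> b) \<and>
      \<xi> i \<omega> + (\<Sum>j\<in>?I - {i}. \<xi> j \<omega>) - x \<in> D})"
  have ev: "E1 i \<in> events" for i unfolding E1_def by measurable
  have "n * (l * (1 - \<eta>)) = (\<Sum>i\<in>?I. l * (1 - \<eta>))" by simp
  also have "\<dots> \<le> (\<Sum>i\<in>?I. prob (E1 i))"
  proof (rule sum_mono)
    fix i assume i: "i \<in> ?I"
    define c where "c = real (card (?I - {i}))"
    have c: "c \<le> n" "0 \<le> c" using card_mono[of ?I "?I - {i}"] by (auto simp: c_def)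
    have "c / \<kappa>\<^sup>2 \<le> n / \<kappa>\<^sup>2" "c * G \<le> n * G"
      using c by (auto intro: divide_right_mono mult_right_mono simp: G)
    then have "l * (1 - \<eta>) \<le> l * (1 - (c / \<kappa>\<^sup>2 + c * G))"
      using l unfolding \<eta> by (intro mult_left_mono) auto
    also have "\<dots> \<le> prob (E1 i)" unfolding E1_def c_def G
      by (rule big_jump_lower[OF _ _ D \<kappa> l near]) auto
    finally show "l * (1 - \<eta>) \<le> prob (E1 i)" .
  qed
  also have "\<dots> = prob (\<Union>i\<in>?I. E1 i)"
  proof (rule finite_measure_finite_Union[symmetric])
    show "disjoint_family_on E1 ?I"
    unfolding disjoint_family_on_def
    proof (intro ballI impI)
      fix i j assume "i \<in> ?I" "j \<in> ?I" "i \<noteq> j"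
      then have "j \<in> ?I - {i}" by auto
      then show "E1 i \<inter> E1 j = {}" unfolding E1_def by force
    qed
  qed (use ev in auto)
  also have "\<dots> \<le> prob {\<omega> \<in> space M. (\<Sum>i=1..n. \<xi> i \<omega>) - x \<in> D}"
  proof (rule finite_measure_mono)
    show "(\<Union>i\<in>?I. E1 i) \<subseteq> {\<omega> \<in> space M. (\<Sum>i=1..n. \<xi> i \<omega>) - x \<in> D}"
    proof (rule UN_least, rule subsetI)
      fix i \<omega> assume i: "i \<in> ?I" and \<omega>: "\<omega> \<in> E1 i"
      have "(\<Sum>i\<in>?I. \<xi> i \<omega>) = \<xi> i \<omega> + (\<Sum>j\<in>?I - {i}. \<xi> j \<omega>)"
        using i by (intro sum.remove) auto
      then show "\<omega> \<in> {\<omega> \<in> space M. (\<Sum>i=1..n. \<xi> i \<omega>) - x \<in> D}"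
        using \<omega> by (simp add: E1_def)
    qed
  qed measurable
  finally show ?thesis .
qed

end

section \<open>Asymptotics\<close>

text \<open>The sets decrease in \<open>N\<close> and hence form a filter base. Statements uniform
  in \<open>x\<close> thus become statements along one filter, to which the usual limit rules
  apply.\<close>

lemma eventually_uniform_tail:
  fixes X :: "nat \<Rightarrow> real"
  shows "eventually P (INF N. principal {w. N \<le> fst w \<and> X (fst w) \<le> snd w}) \<longleftrightarrow>
    (\<exists>N. \<forall>n\<ge>N. \<forall>x\<ge>X n. P (n, x))"
proof -
  have "eventually P (INF N. principal {w. N \<le> fst w \<and> X (fst w) \<le> snd w}) \<longleftrightarrow>
      (\<exists>N\<in>UNIV. eventually P (principal {w. N \<le> fst w \<and> X (fst w) \<le> snd w}))"
  proof (rule eventually_INF_base)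
    fix a b :: nat
    show "\<exists>x\<in>UNIV. principal {w. x \<le> fst w \<and> X (fst w) \<le> snd w} \<le>
        inf (principal {w. a \<le> fst w \<and> X (fst w) \<le> snd w}) (principal {w. b \<le> fst w \<and> X (fst w) \<le> snd w})"
      by (intro bexI[of _ "max a b"]) auto
  qed simp
  then show ?thesis by (auto simp: eventually_principal)
qed

text \<open>\<open>\<Delta>\<close> enters as a Borel set \<open>D\<close> of positive numbers
  containing some \<open>{0<..\<tau>}\<close>, which treats finite and infinite \<open>T\<close>
  alike.\<close>

locale big_jump_domain =
  standardized_iid M \<xi> F + stretched_tail R p "\<lambda>y. measure F {a. a - y \<in> D}" \<alpha> \<gamma> m x1
  for M :: "'a measure" and \<xi> F R p \<alpha> \<gamma> m x1 and D :: "real set" +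
  fixes \<tau> :: real and X :: "nat \<Rightarrow> real"
  assumes D: "D \<in> sets borel" "D \<subseteq> {0<..}"
    and \<tau>: "\<tau> > 0" "{0<..\<tau>} \<subseteq> D"
    and X_at_top: "filterlim X at_top sequentially"
    and X_lim: "(\<lambda>n. sqrt n * (R (X n) / X n)) \<longlonglongrightarrow> 0"
begin

abbreviation q :: "real \<Rightarrow> real" where "q y \<equiv> measure F {a. a - y \<in> D}"

text \<open>Convergence along \<open>U\<close> is convergence as \<open>n\<close> tends to infinity, uniformly for \<open>x \<ge> X n\<close>.\<close>

definition U :: "(nat \<times> real) filter" where
  "U = (INF N. principal {w. N \<le> fst w \<and> X (fst w) \<le> snd w})"

lemma eventually_U: "eventually P U \<longleftrightarrow> (\<exists>N. \<forall>n\<ge>N. \<forall>x\<ge>X n. P (n, x))"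
  unfolding U_def by (rule eventually_uniform_tail)

lemma fst_U: "filterlim fst sequentially U"
  unfolding filterlim_at_top eventually_U by auto

lemma snd_U: "filterlim snd at_top U"
  unfolding filterlim_at_top eventually_U
proof
  fix Z
  have "\<forall>\<^sub>F n in sequentially. Z \<le> X n" using X_at_top by (simp add: filterlim_at_top)
  then show "\<exists>N. \<forall>n\<ge>N. \<forall>x\<ge>X n. Z \<le> snd (n, x)"
    by (auto simp: eventually_sequentially) (metis order_trans)
qed

lemma sqrt_U: "filterlim (\<lambda>w. sqrt (real (fst w))) at_top U"
  by (rule filterlim_compose[OF sqrt_at_top filterlim_compose[OF filterlim_real_sequentially fst_U]])

text \<open>The growth condition concerns \<open>X n\<close> alone; since \<open>R x / x\<close>
  decreases, it passes to all \<open>x \<ge> X n\<close>.\<close>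

lemma sqrt_R_U: "((\<lambda>w. sqrt (real (fst w)) * (R (snd w) / snd w)) \<longlongrightarrow> 0) U"
proof (rule tendsto_sandwich[of "\<lambda>_. 0"])
  show "((\<lambda>w. sqrt (real (fst w)) * (R (X (fst w)) / X (fst w))) \<longlongrightarrow> 0) U"
    by (rule filterlim_compose[OF X_lim fst_U])
  have "\<forall>\<^sub>F n in sequentially. x1 \<le> X n" using X_at_top by (simp add: filterlim_at_top)
  then obtain N where N: "\<And>n. n \<ge> N \<Longrightarrow> x1 \<le> X n" by (auto simp: eventually_sequentially)
  show "\<forall>\<^sub>F w in U. sqrt (real (fst w)) * (R (snd w) / snd w) \<le> sqrt (real (fst w)) * (R (X (fst w)) / X (fst w))"
    unfolding eventually_U fst_conv snd_conv
    by (intro exI[of _ N] allI impI mult_left_mono R_over_antimono N) auto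
  have "\<forall>\<^sub>F w in U. x1 \<le> snd w" using snd_U by (simp add: filterlim_at_top)
  then show "\<forall>\<^sub>F w in U. 0 \<le> sqrt (real (fst w)) * (R (snd w) / snd w)"
  proof eventually_elim
    case (elim w)
    then show ?case using R_pos[of "snd w"] params by simp
  qed
qed auto

lemma sum_asymptotics:
  assumes "\<epsilon>0 > 0"
  shows "\<forall>\<^sub>F w in U. \<bar>prob {\<omega> \<in> space M. (\<Sum>i=1..fst w. \<xi> i \<omega>) - snd w \<in> D} / (real (fst w) * q (snd w)) - 1\<bar> < \<epsilon>0"
proof -
  \<comment> \<open>With this choice \<open>c\<close> is the midpoint of \<open>1\<close> and
    \<open>2 powr (1 - \<gamma>)\<close>. Of the deduction \<open>2 * \<delta>\<close>, one half
    makes \<open>exp ((1 - \<delta>) * R)\<close> integrable and the other yields the small factor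
    \<open>\<rho>\<close>.\<close>
  define \<delta> where "\<delta> = (1 - 2 powr (\<gamma> - 1)) / 4"
  define c where "c = 2 powr (1 - \<gamma>) * (1 - 2 * \<delta>)"
  have \<delta>: "0 < \<delta>" "\<delta> < 1 / 2"
  proof -
    have "2 powr (\<gamma> - 1) < 2 powr 0" using params by (intro powr_less_mono) auto
    then show "0 < \<delta>" by (simp add: \<delta>_def)
    have half: "(1 - t) / 4 < 1 / 2" if "t > 0" for t :: real using that by simp
    show "\<delta> < 1 / 2" unfolding \<delta>_def by (rule half) simp
  qed
  have c: "c > 1"
  proof -
    have "2 powr (1 - \<gamma>) * 2 powr (\<gamma> - 1) = (1::real)" by (simp flip: powr_add)
    moreover have "c = (2 powr (1 - \<gamma>) + 2 powr (1 - \<gamma>) * 2 powr (\<gamma> - 1)) / 2"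
      by (simp add: c_def \<delta>_def distrib_left right_diff_distrib add_divide_distrib diff_divide_distrib)
    ultimately have "c = (2 powr (1 - \<gamma>) + 1) / 2" by simp
    moreover have "(1::real) < 2 powr (1 - \<gamma>)" using params by simp
    ultimately show ?thesis by simp
  qed
  have block: "measure F {y<..y + \<tau>} \<le> q y" for y
    using \<tau> D(1) by (intro F.finite_measure_mono) auto
  obtain x2 where x2: "x2 \<ge> x1" and h_int: "integrable F (\<lambda>x. indicator {x2<..} x * exp ((1 - \<delta>) * R x))"
    using exponential_moment[OF F.finite_measure_axioms sets_F \<tau>(1) block \<delta>(1)] \<delta>(2) by auto
  define h where "h = (\<lambda>x. indicator {x2<..} x * exp ((1 - \<delta>) * R x))"
  define C where "C = (\<integral>t. h t \<partial>F)"
  have C: "C \<ge> 0" unfolding C_def h_def by (intro integral_nonneg_AE) auto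
  obtain C3 x3 where C3: "C3 \<ge> 1" "x3 \<ge> x1"
    and shift: "\<And>x z. x3 \<le> x \<Longrightarrow> z \<le> x / 2 \<Longrightarrow> q (x - z) \<le> C3 * q x * exp (R x / x * max z 0)"
    using q_shift_le by metis
  obtain c0 where c0: "c0 > 0" "\<And>x. x1 \<le> x \<Longrightarrow> c0 * x powr (-m) \<le> p x"
    using p_polynomial_bounds by metis
  define \<epsilon> where "\<epsilon> = min (ln (1 + \<epsilon>0 / 2)) (\<epsilon>0 / 2)"
  have \<epsilon>: "\<epsilon> > 0" "exp \<epsilon> \<le> 1 + \<epsilon>0 / 2" "1 - \<epsilon>0 / 2 \<le> exp (-\<epsilon>)"
  proof -
    show "\<epsilon> > 0" using assms by (simp add: \<epsilon>_def)
    have "exp \<epsilon> \<le> exp (ln (1 + \<epsilon>0 / 2))" by (simp add: \<epsilon>_def)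
    then show "exp \<epsilon> \<le> 1 + \<epsilon>0 / 2" using assms by simp
    show "1 - \<epsilon>0 / 2 \<le> exp (-\<epsilon>)" using exp_ge_add_one_self[of "-\<epsilon>"] by (simp add: \<epsilon>_def)
  qed
  obtain \<delta>' x4 where \<delta>': "\<delta>' > 0" "x4 \<ge> x1"
    and near: "\<And>x z. x4 \<le> x \<Longrightarrow> \<bar>z\<bar> \<le> \<delta>' * x \<Longrightarrow> \<bar>z\<bar> * (R x / x) \<le> \<delta>' \<Longrightarrow>
       exp (-\<epsilon>) * q x \<le> q (x - z) \<and> q (x - z) \<le> exp \<epsilon> * q x"
    using q_near[OF \<epsilon>(1)] by metis
  \<comment> \<open>\<open>2 * C3 / K\<^sup>2\<close> will be the limit of the last term of
    \<open>ub\<close>: \<open>1 / K\<^sup>2\<close> is lost once in the probability of typical sums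
    and once in Chebyshev's bound for the others.\<close>
  obtain K where K: "K > 0" "2 * C3 / K\<^sup>2 < \<epsilon>0 / 2" "1 / K\<^sup>2 < \<epsilon>0 / 2"
  proof -
    have "\<forall>\<^sub>F K in at_top. 2 * C3 / K\<^sup>2 < \<epsilon>0 / 2" "\<forall>\<^sub>F K in at_top. 1 / K\<^sup>2 < \<epsilon>0 / 2"
      by (rule order_tendstoD, real_asymp, use assms in simp)+
    with eventually_gt_at_top[of 0]
    have "\<forall>\<^sub>F K in at_top. K > 0 \<and> 2 * C3 / K\<^sup>2 < \<epsilon>0 / 2 \<and> 1 / K\<^sup>2 < \<epsilon>0 / 2"
      by eventually_elim auto
    then show ?thesis using that by (auto simp: eventually_at_top_linorder)
  qed

  define s where "s = (\<lambda>w::nat \<times> real. c * (R (snd w) / snd w))"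
  \<comment> \<open>The part of the exponential moment beyond \<open>1 / s\<close> carries this
    factor. Eventually \<open>sqrt n \<le> 1 / s\<close>, so \<open>n * \<rho>\<close> is at most
    \<open>n * exp (- \<delta> * R (sqrt n))\<close>, which tends to 0.\<close>
  define \<rho> where "\<rho> = (\<lambda>w. exp (- \<delta> * R (1 / s w)))"
  define r where "r = (\<lambda>w. (s w)\<^sup>2 + \<rho> w * C)"
  define \<Phi> where "\<Phi> = (\<lambda>w. exp (real (fst w) * r w))"
  define G where "G = (\<lambda>w::nat \<times> real. measure F {snd w / 2<..})"
  define \<kappa> where "\<kappa> = (\<lambda>w::nat \<times> real. K * sqrt (real (fst w)))"
  define \<eta> where "\<eta> = (\<lambda>w. real (fst w) / (\<kappa> w)\<^sup>2 + real (fst w) * G w)"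
  \<comment> \<open>This is \<open>x^2 * exp (- c * R x)\<close> divided by the lower bound
    \<open>c0 * x powr (-m) * exp (- R x)\<close> for \<open>q x\<close>; the factor
    \<open>x^2\<close> is there to absorb one \<open>n\<close>.\<close>
  define W where "W = (\<lambda>x. x powr (m + 2) * exp (- (c - 1) * R x) / c0)"

  have s_lim: "((\<lambda>w. s w * sqrt (real (fst w))) \<longlongrightarrow> 0) U"
    using tendsto_mult_left[OF sqrt_R_U, of c] by (simp add: s_def mult_ac)
  have x_ev: "\<forall>\<^sub>F w in U. B \<le> snd w" for B using snd_U by (simp add: filterlim_at_top)
  have n_ev: "\<forall>\<^sub>F w in U. B \<le> sqrt (real (fst w))" for B using sqrt_U by (simp add: filterlim_at_top)
  have n1_ev: "\<forall>\<^sub>F w in U. 1 \<le> fst w" using fst_U by (simp add: filterlim_at_top)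
  have R_ev: "\<forall>\<^sub>F w in U. 1 \<le> R (snd w)"
    using filterlim_compose[OF R_at_top snd_U] by (simp add: filterlim_at_top)
  have sR_ev: "\<forall>\<^sub>F w in U. sqrt (real (fst w)) * (R (snd w) / snd w) \<le> d" if "d > 0" for d
    using order_tendstoD(2)[OF sqrt_R_U that] by eventually_elim simp
  have spos: "\<forall>\<^sub>F w in U. 0 < s w"
    using x_ev[of x1] by eventually_elim (use R_pos params c in \<open>auto simp: s_def intro!: mult_pos_pos divide_pos_pos\<close>)
  have s1_ev: "\<forall>\<^sub>F w in U. sqrt (real (fst w)) \<le> 1 / s w"
    using order_tendstoD(2)[OF s_lim zero_less_one] spos
    by eventually_elim (simp_all add: field_simps)
  have n_le: "\<forall>\<^sub>F w in U. real (fst w) \<le> (snd w)\<^sup>2"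
    using sR_ev[OF zero_less_one] R_ev x_ev[of x1]
  proof eventually_elim
    case (elim w)
    have x: "snd w > 0" using elim params by simp
    have "sqrt (real (fst w)) * (1 / snd w) \<le> sqrt (real (fst w)) * (R (snd w) / snd w)"
      using elim x by (intro mult_left_mono divide_right_mono) auto
    also have "\<dots> \<le> 1" using elim by simp
    finally have "sqrt (real (fst w)) \<le> snd w" using x by (simp add: field_simps)
    then have "(sqrt (real (fst w)))\<^sup>2 \<le> (snd w)\<^sup>2" by (intro power_mono) auto
    then show ?case by simp
  qed

  have \<rho>_lim: "((\<lambda>w. real (fst w) * \<rho> w) \<longlongrightarrow> 0) U"
  proof (rule tendsto_sandwich[of "\<lambda>_. 0"])
    show "((\<lambda>w. sqrt (real (fst w)) powr 2 * exp (- \<delta> * R (sqrt (real (fst w))))) \<longlongrightarrow> 0) U"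
      by (rule filterlim_compose[OF powr_times_exp_R_tendsto[OF \<delta>(1)] sqrt_U])
    show "\<forall>\<^sub>F w in U. real (fst w) * \<rho> w \<le> sqrt (real (fst w)) powr 2 * exp (- \<delta> * R (sqrt (real (fst w))))"
      using s1_ev n_ev[of x1] n1_ev
    proof eventually_elim
      case (elim w)
      have "R (sqrt (real (fst w))) \<le> R (1 / s w)" using elim by (intro R_mono) auto
      then have "\<rho> w \<le> exp (- \<delta> * R (sqrt (real (fst w))))" using \<delta> by (simp add: \<rho>_def)
      then have "real (fst w) * \<rho> w \<le> real (fst w) * exp (- \<delta> * R (sqrt (real (fst w))))" by (intro mult_left_mono) auto
      then show ?case using elim by simp
    qed
  qed (auto simp: \<rho>_def)
  have \<Phi>_lim: "(\<Phi> \<longlongrightarrow> 1) U"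
  proof -
    have "((\<lambda>w. exp ((s w * sqrt (real (fst w)))\<^sup>2 + real (fst w) * \<rho> w * C)) \<longlongrightarrow> exp (0\<^sup>2 + 0 * C)) U"
      by (intro tendsto_intros s_lim \<rho>_lim)
    then show ?thesis by (simp add: \<Phi>_def[abs_def] r_def algebra_simps power_mult_distrib)
  qed
  have mgf: "\<forall>\<^sub>F w in U. truncated_mgf (snd w / 2) (s w) \<le> exp (r w)"
    using s1_ev n_ev[of "x2"] spos x_ev[of x1]
  proof eventually_elim
    case (elim w)
    have s: "x2 \<le> 1 / s w" using elim by simp
    show ?case unfolding r_def C_def
    proof (rule truncated_mgf_le)
      show "integrable F h" using h_int by (simp add: h_def)
      fix t assume t: "1 / s w < t" "t \<le> snd w / 2"
      have tx: "x1 \<le> t" "x2 < t" using t s x2 by auto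
      have "s w * t = (1 - 2 * \<delta>) * (2 powr (1 - \<gamma>) * (R (snd w) / snd w) * t)"
        by (simp add: s_def c_def)
      also have "\<dots> \<le> (1 - 2 * \<delta>) * R t"
        using \<delta> R_halved_ge[OF tx(1) t(2)] by (intro mult_left_mono) auto
      also have "\<dots> \<le> - \<delta> * R (1 / s w) + (1 - \<delta>) * R t"
      proof -
        have "\<delta> * R (1 / s w) \<le> \<delta> * R t" using \<delta> s x2 t by (intro mult_left_mono R_mono) auto
        then show ?thesis by (simp add: algebra_simps)
      qed
      finally have "exp (s w * t) \<le> exp (- \<delta> * R (1 / s w) + (1 - \<delta>) * R t)" by simp
      then show "exp (s w * t) \<le> \<rho> w * h t" using tx by (simp add: \<rho>_def h_def mult_exp_exp)
    qed (use elim in \<open>auto simp: \<rho>_def h_def\<close>)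
  qed
  \<comment> \<open>Markov's inequality for the exponential moment at \<open>x / 2\<close>. Half of
    \<open>c * R x\<close> suffices: in both error terms where \<open>G\<close> is compared with
    \<open>q\<close>, a second factor of this size accompanies it.\<close>
  have G_le: "\<forall>\<^sub>F w in U. G w \<le> C * exp (- c * R (snd w) / 2)"
    using x_ev[of "2 * x2"]
  proof eventually_elim
    case (elim w)
    define b where "b = snd w / 2"
    have b: "x2 \<le> b" "x1 \<le> b" using elim x2 by (auto simp: b_def)
    have x: "snd w > 0" "x1 \<le> snd w" using b params by (auto simp: b_def)
    have "2 powr (1 - \<gamma>) * (R (snd w) / snd w) * b \<le> R b"
      using R_halved_ge[of b "snd w"] b by (simp add: b_def)
    then have "2 powr (1 - \<gamma>) * R (snd w) / 2 \<le> R b" using x by (simp add: b_def)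
    then have "(1 - 2 * \<delta>) * (2 powr (1 - \<gamma>) * R (snd w) / 2) \<le> (1 - 2 * \<delta>) * R b"
      using \<delta> by (intro mult_left_mono) auto
    also have "\<dots> \<le> (1 - \<delta>) * R b" using \<delta> R_pos[OF b(2)] by (intro mult_right_mono) auto
    finally have le: "c * R (snd w) / 2 \<le> (1 - \<delta>) * R b" by (simp add: c_def mult_ac)
    have "G w * exp ((1 - \<delta>) * R b) = (\<integral>t. indicator {b<..} t * exp ((1 - \<delta>) * R b) \<partial>F)"
      by (simp add: G_def b_def)
    also have "\<dots> \<le> C" unfolding C_def
    proof (rule integral_mono)
      show "integrable F (\<lambda>t. indicator {b<..} t * exp ((1 - \<delta>) * R b))"
        by (auto simp: less_top[symmetric])
      show "integrable F h" using h_int by (simp add: h_def)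
      show "indicator {b<..} t * exp ((1 - \<delta>) * R b) \<le> h t" for t
        using R_mono[OF b(2), of t] b \<delta> by (auto simp: indicator_def h_def)
    qed
    finally have "G w * exp ((1 - \<delta>) * R b) * exp (- ((1 - \<delta>) * R b)) \<le> C * exp (- ((1 - \<delta>) * R b))"
      by (intro mult_right_mono) auto
    then have "G w \<le> C * exp (- ((1 - \<delta>) * R b))" by (simp add: mult.assoc flip: exp_add)
    also have "\<dots> \<le> C * exp (- c * R (snd w) / 2)" using le C by (intro mult_left_mono) auto
    finally show ?case .
  qed
  have nG_lim: "((\<lambda>w. real (fst w) * G w) \<longlongrightarrow> 0) U"
  proof (rule tendsto_sandwich[of "\<lambda>_. 0"])
    have "((\<lambda>x. C * (x powr 2 * exp (- (c / 2) * R x))) \<longlongrightarrow> C * 0) at_top"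
      using c by (intro tendsto_mult_left powr_times_exp_R_tendsto) simp
    from filterlim_compose[OF this snd_U]
    show "((\<lambda>w. C * (snd w powr 2 * exp (- (c / 2) * R (snd w)))) \<longlongrightarrow> 0) U" by simp
    show "\<forall>\<^sub>F w in U. real (fst w) * G w \<le> C * (snd w powr 2 * exp (- (c / 2) * R (snd w)))"
      using n_le G_le x_ev[of x1]
    proof eventually_elim
      case (elim w)
      have "real (fst w) * G w \<le> (snd w)\<^sup>2 * (C * exp (- c * R (snd w) / 2))"
        using elim by (intro mult_mono) (auto simp: G_def)
      then show ?case using elim params by (simp add: mult_ac)
    qed
  qed (auto simp: G_def)
  have \<eta>_lim: "(\<eta> \<longlongrightarrow> 1 / K\<^sup>2) U"
  proof -
    have "((\<lambda>w. 1 / K\<^sup>2 + real (fst w) * G w) \<longlongrightarrow> 1 / K\<^sup>2 + 0) U" by (intro tendsto_intros nG_lim)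
    moreover have "\<forall>\<^sub>F w in U. 1 / K\<^sup>2 + real (fst w) * G w = \<eta> w"
      using n1_ev by eventually_elim (use K in \<open>simp add: \<eta>_def \<kappa>_def power_mult_distrib\<close>)
    ultimately show ?thesis by (auto intro: Lim_transform_eventually)
  qed
  have W_lim: "((\<lambda>w. W (snd w)) \<longlongrightarrow> 0) U"
  proof -
    have "((\<lambda>x. x powr (m + 2) * exp (- (c - 1) * R x) / c0) \<longlongrightarrow> 0 / c0) at_top"
      using c c0 by (intro tendsto_divide powr_times_exp_R_tendsto) auto
    then have "(W \<longlongrightarrow> 0) at_top" by (simp add: W_def[abs_def])
    then show ?thesis by (rule filterlim_compose[OF _ snd_U])
  qed
  have W_bound: "\<forall>\<^sub>F w in U. (snd w)\<^sup>2 * exp (- c * R (snd w)) \<le> W (snd w) * q (snd w)"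
    using x_ev[of x1]
  proof eventually_elim
    case (elim w)
    define x where "x = snd w"
    have x: "x1 \<le> x" "x > 0" using elim params by (auto simp: x_def)
    have "x\<^sup>2 * exp (- c * R x) = W x * (c0 * x powr (-m) * exp (- R x))"
    proof -
      have "exp (- (c - 1) * R x) * exp (- R x) = exp (- c * R x)" by (simp add: algebra_simps flip: exp_add)
      moreover have "x powr (m + 2) * x powr (-m) = x\<^sup>2" using x by (simp flip: powr_add)
      moreover have "W x * (c0 * x powr (-m) * exp (- R x)) =
          (x powr (m + 2) * x powr (-m)) * (exp (- (c - 1) * R x) * exp (- R x))"
        using c0 by (simp add: W_def)
      ultimately show ?thesis by simp
    qed
    also have "\<dots> \<le> W x * q x"
      using c0 x by (intro mult_left_mono) (auto simp: q_eq W_def intro!: divide_nonneg_pos)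
    finally show ?case by (simp add: x_def)
  qed

  define ub where "ub = (\<lambda>w. \<Phi> w * W (snd w) + C\<^sup>2 * W (snd w) + C * \<Phi> w * W (snd w) + exp \<epsilon> +
      C3 * (\<Phi> w - exp (- (K * (s w * sqrt (real (fst w))))) * (1 - \<eta> w) + \<eta> w))"
  define lb where "lb = (\<lambda>w. exp (-\<epsilon>) * (1 - \<eta> w))"
  have "(ub \<longlongrightarrow> 1 * 0 + C\<^sup>2 * 0 + C * 1 * 0 + exp \<epsilon> +
      C3 * (1 - exp (- (K * 0)) * (1 - 1 / K\<^sup>2) + 1 / K\<^sup>2)) U"
    unfolding ub_def by (intro tendsto_intros \<Phi>_lim W_lim \<eta>_lim s_lim)
  then have ub_lim: "(ub \<longlongrightarrow> exp \<epsilon> + 2 * C3 / K\<^sup>2) U" by (simp add: algebra_simps)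
  have ub_ev: "\<forall>\<^sub>F w in U. ub w < 1 + \<epsilon>0"
    using \<epsilon>(2) K(2) by (intro order_tendstoD(2)[OF ub_lim]) linarith
  have lb_lim: "(lb \<longlongrightarrow> exp (-\<epsilon>) * (1 - 1 / K\<^sup>2)) U"
    unfolding lb_def by (intro tendsto_intros \<eta>_lim)
  have lb_ev: "\<forall>\<^sub>F w in U. 1 - \<epsilon>0 < lb w"
  proof (rule order_tendstoD(1)[OF lb_lim])
    have "exp (-\<epsilon>) * (1 / K\<^sup>2) \<le> 1 * (1 / K\<^sup>2)" using \<epsilon> by (intro mult_right_mono) auto
    then have "exp (-\<epsilon>) * (1 - 1 / K\<^sup>2) \<ge> exp (-\<epsilon>) - 1 / K\<^sup>2" by (simp add: right_diff_distrib)
    then show "1 - \<epsilon>0 < exp (-\<epsilon>) * (1 - 1 / K\<^sup>2)" using \<epsilon>(3) K(3) by linarith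
  qed
  \<comment> \<open>A bound \<open>d\<close> on \<open>sqrt n * R x / x\<close> gives
    \<open>\<kappa> * R x / x \<le> K * d\<close> and, because \<open>R x \<ge> 1\<close>, also
    \<open>\<kappa> \<le> K * d * x\<close>. The entries of the minimum serve the conditions with
    \<open>\<delta>'\<close> and \<open>\<kappa> \<le> x / 2\<close>.\<close>
  define d where "d = min \<delta>' (1 / 2) / K"
  have d: "d > 0" using \<delta>' K by (simp add: d_def)
  have near_ev: "\<forall>\<^sub>F w in U. \<kappa> w \<le> \<delta>' * snd w \<and> \<kappa> w * (R (snd w) / snd w) \<le> \<delta>' \<and> \<kappa> w \<le> snd w / 2"
    using sR_ev[OF d] R_ev x_ev[of x1]
  proof eventually_elim
    case (elim w)
    have x: "snd w > 0" using elim params by simp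
    have Kd: "K * d \<le> \<delta>'" "K * d \<le> 1 / 2" using K by (auto simp: d_def)
    have 1: "\<kappa> w * (R (snd w) / snd w) \<le> K * d"
      using mult_left_mono[OF elim(1), of K] K by (simp add: \<kappa>_def mult.assoc)
    have "\<kappa> w * (1 / snd w) \<le> \<kappa> w * (R (snd w) / snd w)"
      using elim x K by (intro mult_left_mono divide_right_mono) (auto simp: \<kappa>_def)
    then have "\<kappa> w \<le> K * d * snd w" using 1 x by (simp add: field_simps)
    moreover have "K * d * snd w \<le> \<delta>' * snd w" "K * d * snd w \<le> 1 / 2 * snd w"
      using Kd x by (auto intro: mult_right_mono simp del: mult_le_cancel_right)
    ultimately show ?case using 1 Kd by simp
  qed
  show ?thesis
    using ub_ev lb_ev near_ev mgf G_le W_bound n_le spos n1_ev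
      x_ev[of "max x4 (max x3 (2 * x1))"] x_ev[of 1]
  proof eventually_elim
    case (elim w)
    obtain n x where w: "w = (n, x)" by force
    have x: "x4 \<le> x" "x3 \<le> x" "x1 \<le> x" "1 \<le> x" "n \<ge> 1" using elim params by (auto simp: w)
    define b where "b = x / 2"
    have q0: "q x > 0" using q_pos[OF x(3)] .
    have \<kappa>: "\<kappa> w > 0" "\<kappa> w \<le> b" using elim K x by (auto simp: \<kappa>_def w b_def)
    have nr: "exp (-\<epsilon>) * q x \<le> q (x - z)" "q (x - z) \<le> exp \<epsilon> * q x" if "\<bar>z\<bar> \<le> \<kappa> w" for z
    proof -
      have "R x / x \<ge> 0" using R_pos[OF x(3)] x by simp
      then have "\<bar>z\<bar> * (R x / x) \<le> \<kappa> w * (R x / x)" using that by (intro mult_right_mono)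
      then show "exp (-\<epsilon>) * q x \<le> q (x - z)" "q (x - z) \<le> exp \<epsilon> * q x"
        using near[OF x(1), of z] that elim by (auto simp: w)
    qed
    have far: "q (x - z) \<le> C3 * q x * exp (s w * max z 0)" if "z \<le> b" for z
    proof -
      have "R x / x \<ge> 0" using R_pos[OF x(3)] x by simp
      then have "R x / x \<le> s w" using c mult_right_mono[of 1 c "R x / x"] by (simp add: s_def w)
      then have "R x / x * max z 0 \<le> s w * max z 0" by (intro mult_right_mono) auto
      then have "C3 * q x * exp (R x / x * max z 0) \<le> C3 * q x * exp (s w * max z 0)"
        using C3 by (intro mult_left_mono) auto
      then show ?thesis using shift[OF x(2), of z] that by (simp add: b_def)
    qed
    define P where "P = prob {\<omega> \<in> space M. (\<Sum>i=1..n. \<xi> i \<omega>) - x \<in> D}"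
    define E where "E = exp (- c * R x)"
    have sx: "s w * x = c * R x" using x by (simp add: s_def w)
    have Gb: "G w = measure F {b<..}" by (simp add: G_def w b_def)
    have \<eta>w: "\<eta> w = n / (\<kappa> w)\<^sup>2 + n * G w" by (simp add: \<eta>_def w)
    have r0: "r w \<ge> 0" using C by (simp add: r_def \<rho>_def)
    have upper: "P \<le> \<Phi> w * exp (- s w * x) + (n * G w)\<^sup>2 + n * (G w * (\<Phi> w * exp (- s w * b)) + exp \<epsilon> * q x
        + C3 * q x * (\<Phi> w - exp (- s w * \<kappa> w) * (1 - \<eta> w) + \<eta> w))"
      unfolding P_def
      by (rule sum_local_upper[OF D _ \<kappa> _ _ nr(2) far _ r0 _ Gb \<eta>w])
        (use elim q0 C3 in \<open>auto simp: \<Phi>_def b_def w\<close>)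
    have \<Phi>1: "\<Phi> w \<ge> 1" using r0 by (simp add: \<Phi>_def)
    have WE: "x\<^sup>2 * E \<le> W x * q x" using elim by (simp add: w E_def)
    have "1 * E \<le> x\<^sup>2 * E" using x by (intro mult_right_mono) (auto simp: E_def)
    then have E1: "E \<le> W x * q x" using WE by simp
    have "n * E \<le> x\<^sup>2 * E" using elim by (intro mult_right_mono) (auto simp: E_def w)
    then have En: "n * E \<le> W x * q x" using WE by simp
    have G0: "0 \<le> G w" by (simp add: G_def)
    have GE: "G w \<le> C * exp (- c * R x / 2)" using elim by (simp add: w)
    have EE: "exp (- c * R x / 2) * exp (- c * R x / 2) = E" by (simp add: E_def flip: exp_add)
    have T1: "\<Phi> w * exp (- s w * x) \<le> n * (\<Phi> w * W x * q x)"
    proof -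
      have "\<Phi> w * exp (- s w * x) = \<Phi> w * E" by (simp add: sx E_def)
      also have "\<dots> \<le> 1 * (\<Phi> w * (W x * q x))" using E1 \<Phi>1 by simp
      also have "\<dots> \<le> n * (\<Phi> w * (W x * q x))"
        using x \<Phi>1 E1 order_trans[OF _ E1, of 0] by (intro mult_right_mono) (auto simp: E_def)
      finally show ?thesis by (simp add: mult.assoc)
    qed
    \<comment> \<open>Two factors \<open>exp (- c * R x / 2)\<close> combine to \<open>E\<close>.
      One \<open>n\<close> of the \<open>n^2\<close> pairs is absorbed by
      \<open>n * E \<le> W x * q x\<close>, the other belongs to the normalization
      \<open>n * q x\<close>.\<close>
    have T2: "(n * G w)\<^sup>2 \<le> n * (C\<^sup>2 * W x * q x)"
    proof -
      have "G w * G w \<le> (C * exp (- c * R x / 2)) * (C * exp (- c * R x / 2))"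
        using GE G0 by (intro mult_mono) auto
      also have "\<dots> = C\<^sup>2 * E" by (simp add: EE[symmetric] power2_eq_square mult_ac)
      finally have "(n * n) * (G w * G w) \<le> (n * n) * (C\<^sup>2 * E)" by (intro mult_left_mono) auto
      also have "\<dots> = n * C\<^sup>2 * (n * E)" by simp
      also have "\<dots> \<le> n * C\<^sup>2 * (W x * q x)" using En by (intro mult_left_mono) auto
      finally show ?thesis by (simp add: power2_eq_square mult_ac)
    qed
    have T3: "G w * (\<Phi> w * exp (- s w * b)) \<le> C * \<Phi> w * W x * q x"
    proof -
      have "s w * b = c * R x / 2" using sx by (simp add: b_def)
      then have "G w * (\<Phi> w * exp (- s w * b)) \<le> C * exp (- c * R x / 2) * (\<Phi> w * exp (- c * R x / 2))"
        using GE \<Phi>1 C by (intro mult_mono mult_nonneg_nonneg) auto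
      also have "\<dots> = C * \<Phi> w * E" by (simp add: EE[symmetric] mult_ac)
      also have "\<dots> \<le> C * \<Phi> w * (W x * q x)" using E1 C \<Phi>1 by (intro mult_left_mono) auto
      finally show ?thesis by (simp add: mult.assoc)
    qed
    have "P \<le> n * (\<Phi> w * W x * q x) + n * (C\<^sup>2 * W x * q x) + n * (C * \<Phi> w * W x * q x + exp \<epsilon> * q x
        + C3 * q x * (\<Phi> w - exp (- s w * \<kappa> w) * (1 - \<eta> w) + \<eta> w))"
      using upper T1 T2 mult_left_mono[OF T3, of n] by (simp add: distrib_left)
    also have "\<dots> = n * q x * ub w"
      by (simp add: ub_def w \<kappa>_def algebra_simps)
    also have "\<dots> < n * q x * (1 + \<epsilon>0)" using elim q0 x by (intro mult_strict_left_mono) auto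
    finally have up: "P / (n * q x) < 1 + \<epsilon>0" using q0 x by (simp add: pos_divide_less_eq mult_ac)
    have "n * (exp (-\<epsilon>) * q x * (1 - \<eta> w)) \<le> P"
      unfolding P_def
      by (rule sum_local_lower[OF D \<kappa>(1) _ _ nr(1) Gb \<eta>w]) (use \<kappa> q0 in \<open>auto simp: b_def\<close>)
    then have "n * q x * lb w \<le> P" by (simp add: lb_def mult_ac)
    moreover have "n * q x * (1 - \<epsilon>0) < n * q x * lb w" using elim q0 x by (intro mult_strict_left_mono) auto
    ultimately have "n * q x * (1 - \<epsilon>0) < P" by simp
    then have "1 - \<epsilon>0 < P / (n * q x)" using q0 x by (simp add: pos_less_divide_eq mult_ac)
    with up show ?case by (simp add: P_def w abs_less_iff)
  qed
qed

end

text \<open>On a compact interval the continuous function \<open>R x / x\<close> has a positive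
  minimum, so values \<open>X n\<close> in it for arbitrarily large \<open>n\<close> would keep
  \<open>sqrt n * (R (X n) / X n)\<close> from tending to 0.\<close>

lemma filterlim_at_top_of_scaled_ratio:
  fixes R :: "real \<Rightarrow> real" and X :: "nat \<Rightarrow> real"
  assumes "x0 > 0" "continuous_on {x0..} R" "\<And>x. x \<ge> x0 \<Longrightarrow> R x > 0" "\<And>n. n \<ge> 1 \<Longrightarrow> X n \<ge> x0"
    and lim: "(\<lambda>n. sqrt n * (R (X n) / X n)) \<longlonglongrightarrow> 0"
  shows "filterlim X at_top sequentially"
  unfolding filterlim_at_top
proof
  fix Z :: real
  define B where "B = max Z x0"
  have "continuous_on {x0..B} (\<lambda>x. R x / x)"
    using assms by (intro continuous_intros continuous_on_subset[OF assms(2)]) auto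
  moreover have "{x0..B} \<noteq> {}" by (simp add: B_def)
  ultimately have "\<exists>y\<in>{x0..B}. \<forall>x\<in>{x0..B}. R y / y \<le> R x / x"
    by (intro continuous_attains_inf) auto
  then obtain y where y: "y \<in> {x0..B}" "\<And>x. x \<in> {x0..B} \<Longrightarrow> R y / y \<le> R x / x" by blast
  define \<mu> where "\<mu> = R y / y"
  have \<mu>: "\<mu> > 0" using y assms by (auto simp: \<mu>_def)
  have "filterlim (\<lambda>n. sqrt (real n)) at_top sequentially"
    by (rule filterlim_compose[OF sqrt_at_top filterlim_real_sequentially])
  then have "\<forall>\<^sub>F n in sequentially. 1 / \<mu> \<le> sqrt (real n)" by (simp add: filterlim_at_top)
  moreover have "\<forall>\<^sub>F n in sequentially. sqrt n * (R (X n) / X n) < 1"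
    using order_tendstoD(2)[OF lim] by simp
  ultimately show "\<forall>\<^sub>F n in sequentially. Z \<le> X n"
    using eventually_ge_at_top[of 1]
  proof eventually_elim
    case (elim n)
    show ?case
    proof (rule ccontr)
      assume "\<not> Z \<le> X n"
      then have "X n \<in> {x0..B}" using assms(4)[OF elim(3)] by (auto simp: B_def)
      then have "\<mu> \<le> R (X n) / X n" using y by (simp add: \<mu>_def)
      then have "1 / \<mu> * \<mu> \<le> sqrt n * (R (X n) / X n)"
        using elim \<mu> by (intro mult_mono) auto
      then show False using elim \<mu> by simp
    qed
  qed
qed

theorem theorem8p3:
  fixes M :: "'a measure" and F :: "real measure"
    and \<xi> :: "nat \<Rightarrow> 'a \<Rightarrow> real"  \<comment> \<open>\<open>\<xi> 0\<close> is the generic copy; the summands are \<open>\<xi> 1, \<xi> 2, \<dots>\<close>\<close>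
    and T :: ereal and p R R' :: "real \<Rightarrow> real" and x0 \<beta> :: real and X :: "nat \<Rightarrow> real"
  assumes "prob_space M"
    and "prob_space.indep_vars M (\<lambda>_. borel) \<xi> UNIV"
    and "\<And>i. distr M borel (\<xi> i) = F"
    and "T > 0"
    and "integrable M (\<xi> 0)" and "(\<integral>\<omega>. \<xi> 0 \<omega> \<partial>M) = 0"
    and "integrable M (\<lambda>\<omega>. (\<xi> 0 \<omega>)\<^sup>2)" and "(\<integral>\<omega>. (\<xi> 0 \<omega>)\<^sup>2 \<partial>M) = 1"
    and "x0 > 0"
    and "\<And>x. x \<ge> x0 \<Longrightarrow> measure F ((+) x ` Delta T) = p x * exp (- R x)"
    and "\<And>x. x \<ge> x0 \<Longrightarrow> p x > 0"
    and "long_tailed p"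
    and "intermediate_regularly_varying p"
    and "\<And>x. x \<ge> x0 \<Longrightarrow> R x > 0"
    and "\<And>x. x \<ge> x0 \<Longrightarrow> (R has_real_derivative R' x) (at x within {x0..})"
    and "0 < \<beta>" and "\<beta> < 1"
    and "regularly_varying (\<beta> - 1) R'"
    and "\<And>n. n \<ge> 1 \<Longrightarrow> X n \<ge> x0"
    and "(\<lambda>n. sqrt (real n) / (X n / R (X n))) \<longlonglongrightarrow> 0"
  shows "(\<lambda>n. SUP x\<in>{X n..}. ereal \<bar>measure M {\<omega> \<in> space M. (\<Sum>i=1..n. \<xi> i \<omega>) \<in> (+) x ` Delta T}
                / (real n * measure F ((+) x ` Delta T)) - 1\<bar>) \<longlonglongrightarrow> 0"
proof -
  define D where "D = Delta T"
  \<comment> \<open>For \<open>T = \<infinity>\<close> any positive length would do; 1 is a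
    default.\<close>
  define \<tau> where "\<tau> = (if T = \<infinity> then 1 else real_of_ereal T)"
  have D: "D \<in> sets borel" "D \<subseteq> {0<..}" by (auto simp: D_def Delta_def)
  have \<tau>: "\<tau> > 0" "{0<..\<tau>} \<subseteq> D"
    using \<open>T > 0\<close> by (cases T; auto simp: \<tau>_def D_def Delta_def)+
  have shift: "t \<in> (+) x ` D \<longleftrightarrow> t - x \<in> D" for t x :: real
    by (metis add_diff_cancel_left' diff_add_cancel add.commute image_iff)
  have image_D: "(+) x ` D = {t. t - x \<in> D}" for x :: real
    using shift by blast
  have X_lim: "(\<lambda>n. sqrt n * (R (X n) / X n)) \<longlonglongrightarrow> 0" using assms(20) by simp
  have "continuous_on {x0..} R"
    using assms(15) by (auto simp: continuous_on_eq_continuous_within intro!: DERIV_continuous)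
  then have X_top: "filterlim X at_top sequentially"
    by (rule filterlim_at_top_of_scaled_ratio[OF \<open>x0 > 0\<close> _ assms(14,19) X_lim])
  obtain \<alpha> \<gamma> b1 where params: "0 < \<alpha>" "0 < \<gamma>" "\<gamma> < 1" and b1: "b1 > 0" "b1 \<ge> x0"
    and R_lower: "\<And>x y. b1 \<le> x \<Longrightarrow> x \<le> y \<Longrightarrow> R x * (y / x) powr \<alpha> \<le> R y"
    and R_upper: "\<And>x y. b1 \<le> x \<Longrightarrow> x \<le> y \<Longrightarrow> R y \<le> R x * (y / x) powr \<gamma>"
    using integrated_regular_variation[OF assms(15,14,18,16,17)] by metis
  obtain m b2 where m: "m \<ge> 0" and b2: "b2 > 0"
    and p_lower: "\<And>x y. b2 \<le> x \<Longrightarrow> x \<le> y \<Longrightarrow> exp (-1) * (y / x) powr (-m) \<le> p y / p x"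
    and p_upper: "\<And>x y. b2 \<le> x \<Longrightarrow> x \<le> y \<Longrightarrow> p y / p x \<le> exp 1 * (y / x) powr m"
    using intermediate_regularly_varying_polynomial[OF assms(13)] by metis
  interpret prob_space M by fact
  interpret big_jump_domain M \<xi> F R p \<alpha> \<gamma> m "max b1 b2" D \<tau> X
  proof
    show "\<exists>\<delta>>0. \<exists>a. \<forall>x y. a \<le> x \<longrightarrow> x \<le> y \<longrightarrow> y \<le> (1 + \<delta>) * x \<longrightarrow>
        exp (-\<eta>) \<le> p y / p x \<and> p y / p x \<le> exp \<eta>" if "\<eta> > 0" for \<eta>
      using intermediate_regularly_varying_near[OF assms(13) that] by metis
    show "measure F {a. a - x \<in> D} = p x * exp (- R x)" if "max b1 b2 \<le> x" for x
      using assms(10)[of x] that b1 by (simp add: image_D flip: D_def)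
  qed (use assms(1-8,11,14) params m b1 b2 R_lower R_upper p_lower p_upper D \<tau> X_top X_lim in auto)
  define f where "f = (\<lambda>n x. \<bar>prob {\<omega> \<in> space M. (\<Sum>i=1..n. \<xi> i \<omega>) \<in> (+) x ` Delta T}
                / (real n * measure F ((+) x ` Delta T)) - 1\<bar>)"
  have f_eq: "f n x = \<bar>prob {\<omega> \<in> space M. (\<Sum>i=1..n. \<xi> i \<omega>) - x \<in> D} / (real n * q x) - 1\<bar>" for n x
    by (simp add: f_def shift image_D flip: D_def)
  have "(\<lambda>n. SUP x\<in>{X n..}. ereal (f n x)) \<longlonglongrightarrow> 0"
  proof (rule order_tendstoI)
    fix a :: ereal assume a: "a < 0"
    show "\<forall>\<^sub>F n in sequentially. a < (SUP x\<in>{X n..}. ereal (f n x))"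
    proof (rule always_eventually, rule allI)
      fix n
      have "0 \<le> ereal (f n (X n))" by (simp add: f_def)
      also have "\<dots> \<le> (SUP x\<in>{X n..}. ereal (f n x))" by (intro SUP_upper) simp
      finally show "a < (SUP x\<in>{X n..}. ereal (f n x))" using a by simp
    qed
  next
    fix a :: ereal assume "0 < a"
    \<comment> \<open>Strict bounds at each \<open>x\<close> give only a weak bound on the supremum,
      so \<open>\<epsilon>\<close> is taken strictly below \<open>a\<close>.\<close>
    then obtain \<epsilon> :: real where \<epsilon>: "\<epsilon> > 0" "ereal \<epsilon> < a"
      using ereal_dense2[of 0 a] by auto
    from sum_asymptotics[OF \<epsilon>(1)]
    obtain N where N: "\<And>n x. n \<ge> N \<Longrightarrow> x \<ge> X n \<Longrightarrow> f n x < \<epsilon>"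
      unfolding eventually_U by (auto simp: f_eq)
    show "\<forall>\<^sub>F n in sequentially. (SUP x\<in>{X n..}. ereal (f n x)) < a"
      using eventually_ge_at_top[of N]
    proof eventually_elim
      case (elim n)
      have "(SUP x\<in>{X n..}. ereal (f n x)) \<le> ereal \<epsilon>"
        using N[OF elim] by (intro SUP_least) (auto intro: less_imp_le)
      then show ?case using \<epsilon> by simp
    qed
  qed
  then show ?thesis unfolding f_def .
qed

end
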